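(* Let $K$ be an algebraically closed field of characteristic zero. Any non-singular projective plane curve $C\subset\mathbb{P}^2(K)$ of degree $d\geq 4$ which has an automorphism of order $d^2-3d+3$ is isomorphic to the Klein curve $K_d: X^{d-1}Y+Y^{d-1}Z+Z^{d-1}X=0$. In particular, for $d\geq 5$, $Aut(C)$ is isomorphic to $$\langle\tau,\sigma\mid \tau^{d^2-3d+3}=\sigma^3=1,\ \tau\sigma=\sigma\tau^{-(d-1)}\rangle.$$
   Context: $Aut(C)$ is the full automorphism group of $C$ over $K$, identified with the finite subgroup of $PGL_3(K)$ preserving the defining equation of $C$. *)

theory Defs
  imports
    "HOL-Analysis.Determinants"
    "HOL-Library.Poly_Mapping"
    "HOL-Computational_Algebra.Polynomial"
    "HOL-Algebra.Multiplicative_Group"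
begin

section \<open>Polynomials in three variables\<close>

text \<open>
  A polynomial maps exponent vectors to coefficients; \<open>Poly_Mapping\<close> provides the ring structure.
  The variables are indexed by the three-element type \<open>3\<close>, as are the coordinates of vectors.
\<close>

type_synonym 'k poly3 = "(3 \<Rightarrow>\<^sub>0 nat) \<Rightarrow>\<^sub>0 'k"

definition Const :: "'k::zero \<Rightarrow> 'k poly3" where
  "Const c = Poly_Mapping.single 0 c"

definition Var :: "3 \<Rightarrow> 'k::zero_neq_one poly3" where
  "Var i = Poly_Mapping.single (Poly_Mapping.single i 1) 1"

text \<open>Substitute \<open>f i\<close> for the \<open>i\<close>-th variable and apply \<open>h\<close> to the coefficients.\<close>

definition insertion ::
  "('k::zero \<Rightarrow> 'r::comm_semiring_1) \<Rightarrow> (3 \<Rightarrow> 'r) \<Rightarrow> 'k poly3 \<Rightarrow> 'r" where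
  "insertion h f p =
     (\<Sum>m\<in>Poly_Mapping.keys p. h (Poly_Mapping.lookup p m) * (\<Prod>i\<in>UNIV. f i ^ Poly_Mapping.lookup m i))"

definition poly3_eval :: "'k::comm_semiring_1 poly3 \<Rightarrow> 'k^3 \<Rightarrow> 'k" where
  "poly3_eval p v = insertion (\<lambda>c. c) (\<lambda>i. v $ i) p"

definition linear_form :: "'k::comm_semiring_1^3^3 \<Rightarrow> 3 \<Rightarrow> 'k poly3" where
  "linear_form A i = (\<Sum>j\<in>UNIV. Const (A $ i $ j) * Var j)"

text \<open>The polynomial \<open>F(A X)\<close>, where \<open>X\<close> is the column vector of the variables.\<close>

definition linear_subst :: "'k::comm_semiring_1^3^3 \<Rightarrow> 'k poly3 \<Rightarrow> 'k poly3" where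
  "linear_subst A F = insertion Const (linear_form A) F"

definition partial_deriv :: "3 \<Rightarrow> 'k::comm_semiring_1 poly3 \<Rightarrow> 'k poly3" where
  "partial_deriv i p =
     (\<Sum>m\<in>Poly_Mapping.keys p. Poly_Mapping.single (m - Poly_Mapping.single i 1)
                                  (of_nat (Poly_Mapping.lookup m i) * Poly_Mapping.lookup p m))"

definition homogeneous :: "nat \<Rightarrow> 'k::zero poly3 \<Rightarrow> bool" where
  "homogeneous d p \<longleftrightarrow> (\<forall>m\<in>Poly_Mapping.keys p. (\<Sum>i\<in>UNIV. Poly_Mapping.lookup m i) = d)"


section \<open>Plane projective curves\<close>

text \<open>A point of the projective plane is the set of its homogeneous coordinate vectors.\<close>

definition proj_point :: "'k::field^3 \<Rightarrow> ('k^3) set" where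
  "proj_point v = {c *s v | c. c \<noteq> 0}"

definition curve_points :: "'k::field poly3 \<Rightarrow> ('k^3) set set" where
  "curve_points F = {proj_point v | v. v \<noteq> 0 \<and> poly3_eval F v = 0}"

text \<open>
  A curve is given by its defining equation \<open>F\<close>. The Jacobian criterion makes \<open>F\<close> squarefree
  (indeed irreducible), so over an algebraically closed field the curve is determined by
  \<open>curve_points F\<close>.
\<close>

definition nonsingular_plane_curve :: "nat \<Rightarrow> 'k::field poly3 \<Rightarrow> bool" where
  "nonsingular_plane_curve d F \<longleftrightarrow>
     F \<noteq> 0 \<and> homogeneous d F \<and>
     \<not> (\<exists>v. v \<noteq> 0 \<and> poly3_eval F v = 0 \<and> (\<forall>i. poly3_eval (partial_deriv i F) v = 0))"

text \<open>
  Near every point, on a basic Zariski-open set where \<open>H\<close> does not vanish, a morphism is given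
  by forms \<open>P 1\<close>, \<open>P 2\<close>, \<open>P 3\<close> of a common degree without common zero there.
\<close>

definition curve_morphism ::
  "'k::field poly3 \<Rightarrow> 'k poly3 \<Rightarrow> (('k^3) set \<Rightarrow> ('k^3) set) \<Rightarrow> bool" where
  "curve_morphism F G \<phi> \<longleftrightarrow>
     \<phi> \<in> curve_points F \<rightarrow> curve_points G \<and>
     (\<forall>v. v \<noteq> 0 \<and> poly3_eval F v = 0 \<longrightarrow>
        (\<exists>H P m n. homogeneous m H \<and> (\<forall>i. homogeneous n (P i)) \<and> poly3_eval H v \<noteq> 0 \<and>
           (\<forall>w. w \<noteq> 0 \<and> poly3_eval F w = 0 \<and> poly3_eval H w \<noteq> 0 \<longrightarrow>
              (\<chi> i. poly3_eval (P i) w) \<noteq> 0 \<and>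
              \<phi> (proj_point w) = proj_point (\<chi> i. poly3_eval (P i) w))))"

definition curves_isomorphic :: "'k::field poly3 \<Rightarrow> 'k poly3 \<Rightarrow> bool" where
  "curves_isomorphic F G \<longleftrightarrow>
     (\<exists>\<phi> \<psi>. curve_morphism F G \<phi> \<and> curve_morphism G F \<psi> \<and>
        (\<forall>p\<in>curve_points F. \<psi> (\<phi> p) = p) \<and> (\<forall>q\<in>curve_points G. \<phi> (\<psi> q) = q))"

definition klein_curve :: "nat \<Rightarrow> 'k::field poly3" where
  "klein_curve d =
     Var 1 ^ (d - 1) * Var 2 + Var 2 ^ (d - 1) * Var 3 + Var 3 ^ (d - 1) * Var 1"


section \<open>The automorphism group\<close>

definition GL3 :: "('k::field^3^3) monoid" where
  "GL3 = \<lparr>carrier = {A. invertible A}, mult = (**), one = mat 1\<rparr>"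

definition scalar_matrices :: "('k::field^3^3) set" where
  "scalar_matrices = {mat c | c. c \<noteq> 0}"

definition PGL3 :: "('k::field^3^3) set monoid" where
  "PGL3 = GL3 Mod scalar_matrices"

definition preserves_equation :: "'k::field^3^3 \<Rightarrow> 'k poly3 \<Rightarrow> bool" where
  "preserves_equation A F \<longleftrightarrow> (\<exists>c. c \<noteq> 0 \<and> linear_subst A F = Const c * F)"

definition Aut :: "'k::field poly3 \<Rightarrow> ('k^3^3) set monoid" where
  "Aut F = PGL3\<lparr>carrier :=
     {scalar_matrices #>\<^bsub>GL3\<^esub> A | A. A \<in> carrier GL3 \<and> preserves_equation A F}\<rparr>"


section \<open>Groups given by generators and relations\<close>

text \<open>
  A word is a list of letters \<open>(g, b)\<close>, standing for the generator \<open>g\<close> if \<open>b\<close> holds and for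
  its formal inverse otherwise. A pair \<open>(l, r)\<close> of words in \<open>R\<close> is the relation \<open>l = r\<close>.
\<close>

type_synonym 'g word = "('g \<times> bool) list"

inductive word_cong :: "('g word \<times> 'g word) set \<Rightarrow> 'g word \<Rightarrow> 'g word \<Rightarrow> bool"
  for R :: "('g word \<times> 'g word) set" where
  refl: "word_cong R u u"
| sym: "word_cong R u v \<Longrightarrow> word_cong R v u"
| trans: "word_cong R u v \<Longrightarrow> word_cong R v w \<Longrightarrow> word_cong R u w"
| cancel: "word_cong R (u @ [(g, b), (g, \<not> b)] @ v) (u @ v)"
| rel: "(l, r) \<in> R \<Longrightarrow> word_cong R (u @ l @ v) (u @ r @ v)"

definition word_class :: "('g word \<times> 'g word) set \<Rightarrow> 'g word \<Rightarrow> 'g word set" where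
  "word_class R u = {v. word_cong R u v}"

definition presented_group :: "('g word \<times> 'g word) set \<Rightarrow> 'g word set monoid" where
  "presented_group R =
     \<lparr>carrier = range (word_class R),
      mult = (\<lambda>U V. \<Union>u\<in>U. \<Union>v\<in>V. word_class R (u @ v)),
      one = word_class R []\<rparr>"

datatype generator = Tau | Sigma

definition klein_relations :: "nat \<Rightarrow> (generator word \<times> generator word) set" where
  "klein_relations d =
     {(replicate (d\<^sup>2 - 3 * d + 3) (Tau, True), []),
      (replicate 3 (Sigma, True), []),
      ([(Tau, True), (Sigma, True)], (Sigma, True) # replicate (d - 1) (Tau, False))}"


section \<open>The structures above are groups\<close>

lemma word_cong_append:
  assumes "word_cong R u u'" "word_cong R v v'"
  shows "word_cong R (u @ v) (u' @ v')"
proof -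
  have l: "word_cong R (w @ u) (w @ u')" if "word_cong R u u'" for u u' w
    using that
  proof induction
    case (cancel u g b v)
    then show ?case using word_cong.cancel[of R "w @ u" g b v] by simp
  next
    case (rel l r u v)
    then show ?case using word_cong.rel[of l r R "w @ u" v] by simp
  qed (auto intro: word_cong.refl word_cong.sym elim: word_cong.trans)
  have r: "word_cong R (u @ w) (u' @ w)" if "word_cong R u u'" for u u' w
    using that
  proof induction
    case (cancel u g b v)
    then show ?case using word_cong.cancel[of R u g b "v @ w"] by simp
  next
    case (rel l r u v)
    then show ?case using word_cong.rel[of l r R u "v @ w"] by simp
  qed (auto intro: word_cong.refl word_cong.sym elim: word_cong.trans)
  show ?thesis using l[OF assms(2)] r[OF assms(1)] word_cong.trans by blast
qed

lemma word_class_eq_iff: "word_class R u = word_class R v \<longleftrightarrow> word_cong R u v"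
proof
  assume "word_class R u = word_class R v"
  then show "word_cong R u v"
    using word_cong.refl[of R v] by (auto simp: word_class_def)
next
  assume uv: "word_cong R u v"
  then show "word_class R u = word_class R v"
    using word_cong.trans[OF uv] word_cong.trans[OF word_cong.sym[OF uv]]
    by (auto simp: word_class_def)
qed

lemma presented_group_mult:
  "word_class R u \<otimes>\<^bsub>presented_group R\<^esub> word_class R v = word_class R (u @ v)"
proof -
  have "word_class R (u' @ v') = word_class R (u @ v)"
    if "u' \<in> word_class R u" "v' \<in> word_class R v" for u' v'
    using that word_cong_append[of R u u' v v'] word_class_eq_iff[of R "u @ v" "u' @ v'"]
    by (simp add: word_class_def)
  then have "(\<Union>u'\<in>word_class R u. \<Union>v'\<in>word_class R v. word_class R (u' @ v')) =
      (\<Union>u'\<in>word_class R u. \<Union>v'\<in>word_class R v. word_class R (u @ v))"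
    by (simp cong: SUP_cong)
  moreover have "word_class R u \<noteq> {}" "word_class R v \<noteq> {}"
    using word_cong.refl by (auto simp: word_class_def)
  ultimately show ?thesis
    by (simp add: presented_group_def)
qed

lemma group_presented_group: "group (presented_group R)"
proof -
  have cls: "\<exists>u. U = word_class R u" if "U \<in> carrier (presented_group R)" for U
    using that by (auto simp: presented_group_def)
  have mem: "word_class R u \<in> carrier (presented_group R)" for u
    by (simp add: presented_group_def)
  have one: "\<one>\<^bsub>presented_group R\<^esub> = word_class R []"
    by (simp add: presented_group_def)
  show ?thesis
  proof (rule groupI)
    fix U assume "U \<in> carrier (presented_group R)"
    then obtain u where u: "U = word_class R u" by (auto simp: presented_group_def)
    define u' where "u' = rev (map (\<lambda>(g, b). (g, \<not> b)) u)"
    have "word_cong R (rev (map (\<lambda>(g, b). (g, \<not> b)) w) @ w) []" for w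
    proof (induction w)
      case (Cons a w)
      obtain g b where a: "a = (g, b)" by force
      have "word_cong R (rev (map (\<lambda>(g, b). (g, \<not> b)) w) @ [(g, \<not> b), (g, \<not> \<not> b)] @ w)
              (rev (map (\<lambda>(g, b). (g, \<not> b)) w) @ w)"
        by (rule word_cong.cancel)
      then show ?case using Cons by (auto simp: a intro: word_cong.trans)
    qed (simp add: word_cong.refl)
    then have "word_class R u' \<otimes>\<^bsub>presented_group R\<^esub> U = \<one>\<^bsub>presented_group R\<^esub>"
      unfolding u presented_group_mult
      by (simp add: u'_def presented_group_def word_class_eq_iff)
    then show "\<exists>V\<in>carrier (presented_group R).
        V \<otimes>\<^bsub>presented_group R\<^esub> U = \<one>\<^bsub>presented_group R\<^esub>"
      by (intro bexI[of _ "word_class R u'"]) (auto simp: presented_group_def)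
  next
    fix U V assume "U \<in> carrier (presented_group R)" "V \<in> carrier (presented_group R)"
    then show "U \<otimes>\<^bsub>presented_group R\<^esub> V \<in> carrier (presented_group R)"
      using cls mem by (metis presented_group_mult)
  next
    show "\<one>\<^bsub>presented_group R\<^esub> \<in> carrier (presented_group R)"
      by (simp add: one mem)
  next
    fix U V W
    assume "U \<in> carrier (presented_group R)" "V \<in> carrier (presented_group R)"
      "W \<in> carrier (presented_group R)"
    then obtain u v w where "U = word_class R u" "V = word_class R v" "W = word_class R w"
      using cls by metis
    then show "U \<otimes>\<^bsub>presented_group R\<^esub> V \<otimes>\<^bsub>presented_group R\<^esub> W =
        U \<otimes>\<^bsub>presented_group R\<^esub> (V \<otimes>\<^bsub>presented_group R\<^esub> W)"
      by (simp add: presented_group_mult)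
  next
    fix U assume "U \<in> carrier (presented_group R)"
    then obtain u where "U = word_class R u" using cls by metis
    then show "\<one>\<^bsub>presented_group R\<^esub> \<otimes>\<^bsub>presented_group R\<^esub> U = U"
      by (simp add: one presented_group_mult)
  qed
qed

lemma group_GL3: "group (GL3 :: ('k::field^3^3) monoid)"
proof (rule groupI)
  fix A :: "'k^3^3" assume "A \<in> carrier GL3"
  then obtain B where "A ** B = mat 1" "B ** A = mat 1"
    by (auto simp: GL3_def invertible_def)
  then show "\<exists>B\<in>carrier GL3. B \<otimes>\<^bsub>GL3\<^esub> A = \<one>\<^bsub>GL3\<^esub>"
    by (auto simp: GL3_def invertible_def)
qed (auto simp: GL3_def invertible_mult matrix_mul_assoc invertible_def[of "mat 1"])

lemma mat_mult_mat: "mat a ** mat b = (mat (a * b) :: 'k::field^3^3)"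
  by (simp add: matrix_matrix_mult_def mat_def vec_eq_iff forall_3 sum_3)

lemma mat_mult_commute: "mat a ** A = A ** (mat a :: 'k::field^3^3)"
  by (simp add: matrix_matrix_mult_def mat_def vec_eq_iff if_distribR if_distrib[of "(*) _"]
      mult.commute cong: if_cong)

lemma invertible_mat: "c \<noteq> 0 \<Longrightarrow> invertible (mat c :: 'k::field^3^3)"
  unfolding invertible_def by (rule exI[of _ "mat (inverse c)"]) (simp add: mat_mult_mat)

lemma normal_scalar_matrices: "scalar_matrices \<lhd> (GL3 :: ('k::field^3^3) monoid)"
proof -
  interpret group "GL3 :: ('k^3^3) monoid" by (rule group_GL3)
  have inv: "inv\<^bsub>GL3\<^esub> (mat c :: 'k^3^3) = mat (inverse c)" if "c \<noteq> 0" for c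
    using that by (intro inv_equality) (simp_all add: GL3_def mat_mult_mat invertible_mat)
  have "subgroup scalar_matrices (GL3 :: ('k^3^3) monoid)"
  proof (rule subgroupI)
    show "inv\<^bsub>GL3\<^esub> A \<in> scalar_matrices" if "A \<in> scalar_matrices" for A :: "'k^3^3"
      using that by (auto simp: scalar_matrices_def inv intro: nonzero_imp_inverse_nonzero)
    show "A \<otimes>\<^bsub>GL3\<^esub> B \<in> scalar_matrices"
      if "A \<in> scalar_matrices" "B \<in> scalar_matrices" for A B :: "'k^3^3"
      using that unfolding scalar_matrices_def GL3_def
      by (auto simp: mat_mult_mat)
    show "scalar_matrices \<noteq> ({} :: ('k^3^3) set)"
      by (auto simp: scalar_matrices_def intro: exI[of _ 1])
  qed (auto simp: scalar_matrices_def GL3_def invertible_mat)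
  moreover have "scalar_matrices #>\<^bsub>GL3\<^esub> A = A <#\<^bsub>GL3\<^esub> scalar_matrices" for A :: "'k^3^3"
    by (auto simp: r_coset_def l_coset_def scalar_matrices_def GL3_def mat_mult_commute)
  ultimately show ?thesis
    by (auto simp: normal_def normal_axioms_def group_GL3)
qed

lemma group_PGL3: "group (PGL3 :: ('k::field^3^3) set monoid)"
  unfolding PGL3_def by (rule normal.factorgroup_is_group[OF normal_scalar_matrices])

lemma insertion_superset:
  assumes "h 0 = 0" "finite S" "Poly_Mapping.keys p \<subseteq> S"
  shows "insertion h f p =
    (\<Sum>m\<in>S. h (Poly_Mapping.lookup p m) * (\<Prod>i\<in>UNIV. f i ^ Poly_Mapping.lookup m i))"
  unfolding insertion_def using assms
  by (intro sum.mono_neutral_left) (auto simp: in_keys_iff)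

lemma insertion_zero [simp]: "insertion h f 0 = 0"
  by (simp add: insertion_def)

lemma insertion_single:
  assumes "h 0 = 0"
  shows "insertion h f (Poly_Mapping.single m c) =
    h c * (\<Prod>i\<in>UNIV. f i ^ Poly_Mapping.lookup m i)"
  using insertion_superset[of h "{m}" "Poly_Mapping.single m c" f] assms by simp

lemma insertion_add:
  assumes "h 0 = 0" "\<And>a b. h (a + b) = h a + h b"
  shows "insertion h f (p + q) = insertion h f p + insertion h f q"
proof -
  let ?S = "Poly_Mapping.keys p \<union> Poly_Mapping.keys q"
  have "Poly_Mapping.keys (p + q) \<subseteq> ?S" by (rule Poly_Mapping.keys_add)
  then show ?thesis
    using assms
    by (simp add: insertion_superset[of h ?S] lookup_add distrib_right sum.distrib)
qed

lemma insertion_sum: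
  assumes "h 0 = 0" "\<And>a b. h (a + b) = h a + h b"
  shows "insertion h f (sum g I) = (\<Sum>i\<in>I. insertion h f (g i))"
  by (induction I rule: infinite_finite_induct) (simp_all add: insertion_add assms)

lemma poly3_as_sum:
  "(p :: 'k::comm_monoid_add poly3) =
    (\<Sum>m\<in>Poly_Mapping.keys p. Poly_Mapping.single m (Poly_Mapping.lookup p m))"
  by (rule poly_mapping_eqI)
    (auto simp: lookup_sum lookup_single when_def in_keys_iff)

lemma insertion_mult:
  fixes h :: "'k::comm_semiring_1 \<Rightarrow> 'r::comm_semiring_1"
  assumes h: "h 0 = 0" "\<And>a b. h (a + b) = h a + h b" "\<And>a b. h (a * b) = h a * h b"
  shows "insertion h f (p * q) = insertion h f p * insertion h f q"
proof -
  have "insertion h f (p * q) = insertion h f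
      ((\<Sum>m\<in>Poly_Mapping.keys p. Poly_Mapping.single m (Poly_Mapping.lookup p m)) *
       (\<Sum>n\<in>Poly_Mapping.keys q. Poly_Mapping.single n (Poly_Mapping.lookup q n)))"
    by (simp flip: poly3_as_sum)
  also have "\<dots> = (\<Sum>m\<in>Poly_Mapping.keys p. \<Sum>n\<in>Poly_Mapping.keys q.
      (h (Poly_Mapping.lookup p m) * (\<Prod>i\<in>UNIV. f i ^ Poly_Mapping.lookup m i)) *
      (h (Poly_Mapping.lookup q n) * (\<Prod>i\<in>UNIV. f i ^ Poly_Mapping.lookup n i)))"
    by (simp add: sum_product insertion_sum h mult_single insertion_single lookup_add
        power_add prod.distrib mult_ac)
  also have "\<dots> = insertion h f p * insertion h f q"
    by (simp add: insertion_def sum_product)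
  finally show ?thesis .
qed

lemma Const_hom [simp]:
  "Const 0 = 0" "Const 1 = 1"
  "Const (a + b) = Const a + Const (b :: 'k::comm_semiring_1)"
  "Const (a * b) = Const a * Const b"
  by (simp_all add: Const_def single_add mult_single)

lemma linear_subst_Const: "linear_subst A (Const c) = Const c"
  unfolding linear_subst_def Const_def by (subst insertion_single) simp_all

lemma linear_subst_mult: "linear_subst A (p * q) = linear_subst A p * linear_subst A q"
  unfolding linear_subst_def by (simp add: insertion_mult)

lemma linear_subst_sum: "linear_subst A (sum g I) = (\<Sum>i\<in>I. linear_subst A (g i))"
  unfolding linear_subst_def by (simp add: insertion_sum)

lemma linear_subst_one: "linear_subst A 1 = 1"
  using linear_subst_Const[of A 1] by simp

lemma linear_subst_power: "linear_subst A (p ^ n) = linear_subst A p ^ n"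
  by (induction n) (simp_all add: linear_subst_mult linear_subst_one)

lemma linear_subst_prod: "linear_subst A (prod g I) = (\<Prod>i\<in>I. linear_subst A (g i))"
  by (induction I rule: infinite_finite_induct)
    (simp_all add: linear_subst_mult linear_subst_one)

lemma linear_subst_Var: "linear_subst A (Var i) = linear_form A i"
proof -
  have "linear_form A j ^ Poly_Mapping.lookup (Poly_Mapping.single i 1) j =
      (if j = i then linear_form A j else 1)" for j
    by (simp add: lookup_single when_def)
  then have "(\<Prod>j\<in>UNIV. linear_form A j ^ Poly_Mapping.lookup (Poly_Mapping.single i 1) j) =
      linear_form A i"
    by simp
  then show ?thesis
    unfolding linear_subst_def Var_def by (subst insertion_single) simp_all
qed

lemma linear_subst_linear_subst:
  "linear_subst A (linear_subst B F) = linear_subst (B ** A) F"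
proof -
  have "linear_subst A (linear_form B i) = linear_form (B ** A) i" for i
  proof -
    have "linear_subst A (linear_form B i) =
        (\<Sum>j\<in>UNIV. \<Sum>k\<in>UNIV. Const (B $ i $ j * A $ j $ k) * Var k)"
      by (simp add: linear_form_def[of B] linear_subst_sum linear_subst_mult
          linear_subst_Const linear_subst_Var)
        (simp add: linear_form_def sum_distrib_left mult.assoc)
    also have "\<dots> = (\<Sum>k\<in>UNIV. (\<Sum>j\<in>UNIV. Const (B $ i $ j * A $ j $ k)) * Var k)"
      by (subst sum.swap) (simp add: sum_distrib_right)
    also have "\<dots> = linear_form (B ** A) i"
      by (simp add: linear_form_def matrix_matrix_mult_def sum_3)
    finally show ?thesis .
  qed
  then show ?thesis
    by (subst (2 3) linear_subst_def)
      (simp add: insertion_def linear_subst_sum linear_subst_mult linear_subst_prod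
        linear_subst_power linear_subst_Const)
qed

lemma prod_UNIV_3: "(\<Prod>i\<in>UNIV. g i) = g 1 * (g 2 * g (3::3))"
  unfolding UNIV_3 by (simp add: mult.assoc)

lemma linear_subst_one_matrix: "linear_subst (mat 1) F = (F :: 'k::comm_semiring_1 poly3)"
proof -
  have "linear_form (mat 1) i = (Var i :: 'k poly3)" for i :: 3
    by (simp add: linear_form_def mat_def if_distrib[of Const] if_distribR
        if_distrib[of "\<lambda>x. x * _"] cong: if_cong)
  moreover have "(\<Prod>i\<in>UNIV. Var i ^ Poly_Mapping.lookup m i) =
      (Poly_Mapping.single m 1 :: 'k poly3)" for m
  proof -
    have pow: "(Var i :: 'k poly3) ^ n = Poly_Mapping.single (Poly_Mapping.single i n) 1" for i n
      by (induction n) (simp_all add: Var_def mult_single flip: single_add)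
    have "Poly_Mapping.single 1 (Poly_Mapping.lookup m 1) +
        (Poly_Mapping.single 2 (Poly_Mapping.lookup m 2) +
         Poly_Mapping.single 3 (Poly_Mapping.lookup m 3)) = m"
    proof (rule poly_mapping_eqI)
      fix k :: 3
      show "Poly_Mapping.lookup (Poly_Mapping.single 1 (Poly_Mapping.lookup m 1) +
          (Poly_Mapping.single 2 (Poly_Mapping.lookup m 2) +
           Poly_Mapping.single 3 (Poly_Mapping.lookup m 3))) k = Poly_Mapping.lookup m k"
        using exhaust_3[of k] by (auto simp: lookup_add lookup_single when_def)
    qed
    then show ?thesis
      by (simp only: pow prod_UNIV_3 mult_single mult_1)
  qed
  ultimately show ?thesis
    unfolding linear_subst_def insertion_def
    by (simp add: Const_def mult_single flip: poly3_as_sum)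
qed

lemma subgroup_Aut: "subgroup (carrier (Aut F)) PGL3"
proof -
  let ?S = scalar_matrices
  interpret G: group GL3 by (rule group_GL3)
  interpret P: group PGL3 by (rule group_PGL3)
  interpret N: normal ?S GL3 by (rule normal_scalar_matrices)
  have one: "preserves_equation (mat 1) F"
    by (auto simp: preserves_equation_def linear_subst_one_matrix intro: exI[of _ 1])
  have mult: "preserves_equation (A ** B) F"
    if "preserves_equation A F" "preserves_equation B F" for A B
  proof -
    from that obtain a b where "a \<noteq> 0" "b \<noteq> 0"
      "linear_subst A F = Const a * F" "linear_subst B F = Const b * F"
      by (auto simp: preserves_equation_def)
    then have "a * b \<noteq> 0" "linear_subst (A ** B) F = Const (a * b) * F"
      by (simp_all add: linear_subst_mult linear_subst_Const mult.assoc
          flip: linear_subst_linear_subst)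
    then show ?thesis unfolding preserves_equation_def by blast
  qed
  have inv: "preserves_equation (inv\<^bsub>GL3\<^esub> A) F"
    if A: "A \<in> carrier GL3" and "preserves_equation A F" for A
  proof -
    from that obtain a where a: "a \<noteq> 0" "linear_subst A F = Const a * F"
      by (auto simp: preserves_equation_def)
    let ?B = "inv\<^bsub>GL3\<^esub> A"
    have "A ** ?B = mat 1" using G.r_inv[OF A] by (simp add: GL3_def)
    then have "F = Const a * linear_subst ?B F"
      using linear_subst_linear_subst[of ?B A F] a
      by (simp add: linear_subst_mult linear_subst_Const linear_subst_one_matrix)
    then have "Const (inverse a) * F = (Const (inverse a) * Const a) * linear_subst ?B F"
      by (metis mult.assoc)
    then have "linear_subst ?B F = Const (inverse a) * F"
      using a by (simp flip: Const_hom)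
    then show ?thesis
      unfolding preserves_equation_def using a by (intro exI[of _ "inverse a"]) simp
  qed
  show ?thesis
  proof (rule P.subgroupI)
    show "carrier (Aut F) \<subseteq> carrier PGL3"
      by (auto simp: Aut_def PGL3_def carrier_FactGroup)
    show "carrier (Aut F) \<noteq> {}"
      using one G.one_closed by (auto simp: Aut_def GL3_def)
  next
    fix X assume "X \<in> carrier (Aut F)"
    then obtain A where A: "X = ?S #>\<^bsub>GL3\<^esub> A" "A \<in> carrier GL3" "preserves_equation A F"
      by (auto simp: Aut_def)
    then have "inv\<^bsub>PGL3\<^esub> X = ?S #>\<^bsub>GL3\<^esub> inv\<^bsub>GL3\<^esub> A"
      unfolding PGL3_def
      by (subst N.inv_FactGroup) (auto simp: carrier_FactGroup N.rcos_inv)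
    then show "inv\<^bsub>PGL3\<^esub> X \<in> carrier (Aut F)"
      using A inv by (auto simp: Aut_def)
  next
    fix X Y assume "X \<in> carrier (Aut F)" "Y \<in> carrier (Aut F)"
    then obtain A B where A: "X = ?S #>\<^bsub>GL3\<^esub> A" "A \<in> carrier GL3" "preserves_equation A F"
      and B: "Y = ?S #>\<^bsub>GL3\<^esub> B" "B \<in> carrier GL3" "preserves_equation B F"
      by (auto simp: Aut_def)
    then have "X \<otimes>\<^bsub>PGL3\<^esub> Y = ?S #>\<^bsub>GL3\<^esub> (A \<otimes>\<^bsub>GL3\<^esub> B)"
      by (simp add: PGL3_def N.rcos_sum)
    moreover have "preserves_equation (A \<otimes>\<^bsub>GL3\<^esub> B) F"
      using mult[OF A(3) B(3)] by (simp add: GL3_def)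
    ultimately show "X \<otimes>\<^bsub>PGL3\<^esub> Y \<in> carrier (Aut F)"
      using A B G.m_closed by (auto simp: Aut_def)
  qed
qed

lemma group_Aut: "group (Aut F)"
proof -
  have "Aut F = PGL3\<lparr>carrier := carrier (Aut F)\<rparr>" by (simp add: Aut_def)
  then show ?thesis
    using subgroup.subgroup_is_group[OF subgroup_Aut group_PGL3, of F] by simp
qed

end

theory Submission
  imports Defs
begin

text \<open>
  An automorphism of order \<open>n = d\<^sup>2 - 3d + 3\<close> is diagonalizable; in eigencoordinates all monomials of the
  equation have the same weight. Smoothness at the coordinate points provides monomials
  \<open>X\<^sub>i\<^sup>d\<^sup>-\<^sup>1 X\<^sub>j\<close> with \<open>j = j(i)\<close>, and the order \<open>n\<close> is possible only if \<open>i \<mapsto> j(i)\<close>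
  is a 3-cycle. Then no other monomial has the right weight, and scaling the coordinates gives the Klein equation.

  For \<open>d \<ge> 5\<close> the coordinate points are the only points of the Klein curve whose tangent has contact of
  order at least \<open>d - 1\<close>. So automorphisms are monomial matrices, inducing cyclic permutations of the
  coordinates, and modulo scalars the diagonal ones form a cyclic group of order \<open>n\<close>.
\<close>

section \<open>Linear substitutions and restriction to lines\<close>

text \<open>The number \<open>n\<close> is what elimination leaves of the weight equations of a
  3-cycle. After division by one eigenvalue, one of the two remaining ratios is a negative power of
  the other, and that other ratio \<open>x\<close> satisfies
  \<open>x ^ ((d - 2) * (d - 1) + 1) = 1\<close>, where the exponent is \<open>n\<close>. So the
  automorphism is determined modulo scalars by a single primitive \<open>n\<close>-th root of unity,
  and this root later yields the generator \<open>\<tau>\<close> of the group.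

  The bound \<open>d \<ge> 5\<close> in the second claim reflects a real change of behaviour. The
  flex argument uses the coefficients of 1, t, t^2 and t^3 on a tangent line, so it needs contact of
  order at least 4. For \<open>d = 4\<close> the contact order \<open>d - 1 = 3\<close> is that of
  ordinary flexes, which no longer single out the coordinate points, and the Klein quartic has 168
  automorphisms instead of 21.\<close>

lemma insertion_insertion:
  fixes h :: "'k::comm_semiring_1 \<Rightarrow> 'r::comm_semiring_1"
  assumes h: "h 0 = 0" "h 1 = 1" "\<And>a b. h (a + b) = h a + h b" "\<And>a b. h (a * b) = h a * h b"
  shows "insertion h f (insertion Const g F) = insertion h (\<lambda>i. insertion h f (g i)) F"
proof -
  have const: "insertion h f (Const c) = h c" for c
    unfolding Const_def by (subst insertion_single) (simp_all add: h)
  have one: "insertion h f 1 = 1"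
    using const[of 1] by (simp add: h)
  have pow: "insertion h f (p ^ n) = insertion h f p ^ n" for p n
    by (induction n) (simp_all add: one insertion_mult h)
  have prod: "insertion h f (prod p I) = (\<Prod>i\<in>I. insertion h f (p i))" for p and I :: "3 set"
    by (induction I rule: infinite_finite_induct) (simp_all add: one insertion_mult h)
  show ?thesis
    by (subst (2 3) insertion_def) (simp add: insertion_sum insertion_mult prod pow const h)
qed

lemma insertion_Var:
  assumes "h 0 = 0" "h 1 = 1"
  shows "insertion h f (Var i) = f i"
proof -
  have "f j ^ Poly_Mapping.lookup (Poly_Mapping.single i 1) j = (if j = i then f j else 1)" for j
    by (simp add: lookup_single when_def)
  then have "(\<Prod>j\<in>UNIV. f j ^ Poly_Mapping.lookup (Poly_Mapping.single i 1) j) = f i"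
    by simp
  then show ?thesis
    unfolding Var_def by (subst insertion_single) (simp_all add: assms)
qed

lemma insertion_linear_form:
  fixes h :: "'k::comm_semiring_1 \<Rightarrow> 'r::comm_semiring_1"
  assumes h: "h 0 = 0" "h 1 = 1" "\<And>a b. h (a + b) = h a + h b" "\<And>a b. h (a * b) = h a * h b"
  shows "insertion h f (linear_form A i) = (\<Sum>j\<in>UNIV. h (A $ i $ j) * f j)"
proof -
  have const: "insertion h f (Const c) = h c" for c
    unfolding Const_def by (subst insertion_single) (simp_all add: h)
  show ?thesis
    by (simp add: linear_form_def insertion_sum insertion_mult insertion_Var const h)
qed

lemma poly3_eval_linear_subst: "poly3_eval (linear_subst A F) v = poly3_eval F (A *v v)"
proof -
  have "(A *v v) $ i = (\<Sum>j\<in>UNIV. A $ i $ j * v $ j)" for i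
    by (simp add: matrix_vector_mult_def)
  then show ?thesis
    by (simp add: poly3_eval_def linear_subst_def insertion_insertion insertion_linear_form)
qed

lemma poly3_eval_Const_mult: "poly3_eval (Const c * F) v = c * poly3_eval F v"
proof -
  have "insertion (\<lambda>c. c) f (Const c) = c" for c :: 'a and f
    unfolding Const_def by (subst insertion_single) simp_all
  then show ?thesis
    by (simp add: poly3_eval_def insertion_mult)
qed

text \<open>This is \<open>F (v + t w)\<close> as a polynomial in \<open>t\<close>. Its two lowest
  coefficients are the value and the directional derivative at \<open>v\<close>. Smoothness phrased
  through them passes to linear substitutions without a chain rule for partial derivatives.\<close>

definition on_line :: "'k::comm_semiring_1 poly3 \<Rightarrow> 'k^3 \<Rightarrow> 'k^3 \<Rightarrow> 'k poly" where
  "on_line F v w = insertion (\<lambda>c. [:c:]) (\<lambda>i. [:v $ i, w $ i:]) F"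

lemma on_line_linear_subst:
  "on_line (linear_subst A F) v w = on_line F (A *v v) (A *v (w :: 'k::comm_ring_1^3))"
proof -
  have *: "(\<Sum>j\<in>UNIV. [:A $ i $ j:] * [:v $ j, w $ j:]) = [:(A *v v) $ i, (A *v w) $ i:]" for i
    by (simp add: matrix_vector_mult_def sum_3)
  show ?thesis
    unfolding on_line_def linear_subst_def
    by (simp add: insertion_insertion insertion_linear_form flip: *)
qed

lemma coeff_0_on_line: "Polynomial.coeff (on_line F v w) 0 = poly3_eval F (v :: 'k::comm_ring_1^3)"
proof -
  have "poly (on_line F v w) 0 = poly3_eval F v"
    by (simp add: on_line_def poly3_eval_def insertion_def poly_sum poly_prod)
  then show ?thesis
    by (simp add: poly_0_coeff_0)
qed

lemma pderiv_on_line: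
  "pderiv (on_line F v w) =
    (\<Sum>i\<in>UNIV. Polynomial.smult (w $ i) (on_line (partial_deriv i F) v (w :: 'k::idom^3)))"
proof -
  let ?P = "\<lambda>m. \<Prod>i\<in>UNIV. [:v $ i, w $ i:] ^ Poly_Mapping.lookup m i"
  have P: "?P m = [:v $ 1, w $ 1:] ^ Poly_Mapping.lookup m 1 *
      ([:v $ 2, w $ 2:] ^ Poly_Mapping.lookup m 2 * [:v $ 3, w $ 3:] ^ Poly_Mapping.lookup m 3)"
    for m :: "3 \<Rightarrow>\<^sub>0 nat"
    by (rule prod_UNIV_3)
  \<comment> \<open>If the exponent of \<open>i\<close> in \<open>m\<close> is 0, the truncated
    subtraction returns \<open>m\<close> itself, but then the factor
    \<open>of_nat (Poly_Mapping.lookup m i)\<close> kills the term.\<close>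
  have mono: "pderiv (?P m) = (\<Sum>i\<in>UNIV. Polynomial.smult (w $ i * of_nat (Poly_Mapping.lookup m i))
      (?P (m - Poly_Mapping.single i 1)))" for m
    unfolding P sum_3
    by (simp add: pderiv_mult pderiv_power pderiv_pCons lookup_minus lookup_single when_def
        mult_ac smult_add_right add_ac distrib_left)
  have smult: "Polynomial.smult a (sum f S) = (\<Sum>x\<in>S. Polynomial.smult a (f x))"
    for a :: 'k and f :: "(3 \<Rightarrow>\<^sub>0 nat) \<Rightarrow> 'k poly" and S
    using sum_distrib_left[of "[:a:]" f S] by simp
  have deriv: "on_line (partial_deriv i F) v w = (\<Sum>m\<in>Poly_Mapping.keys F.
      Polynomial.smult (of_nat (Poly_Mapping.lookup m i) * Poly_Mapping.lookup F m)
        (?P (m - Poly_Mapping.single i 1)))" for i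
    unfolding on_line_def partial_deriv_def
    by (simp add: insertion_sum insertion_single)
  have "pderiv (on_line F v w) =
      (\<Sum>m\<in>Poly_Mapping.keys F. Polynomial.smult (Poly_Mapping.lookup F m) (pderiv (?P m)))"
    by (simp add: on_line_def insertion_def pderiv_smult higher_pderiv_sum[of 1, simplified])
  also have "\<dots> = (\<Sum>i\<in>UNIV. Polynomial.smult (w $ i) (on_line (partial_deriv i F) v w))"
    by (simp add: mono deriv sum_3 smult smult_add_right mult_ac sum.distrib)
  finally show ?thesis .
qed

lemma coeff_1_on_line:
  "Polynomial.coeff (on_line F v w) 1 = (\<Sum>i\<in>UNIV. w $ i * poly3_eval (partial_deriv i F) (v :: 'k::idom^3))"
proof -
  have "Polynomial.coeff (on_line F v w) 1 = Polynomial.coeff (pderiv (on_line F v w)) 0"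
    by (simp add: coeff_pderiv)
  then show ?thesis
    by (simp add: pderiv_on_line coeff_sum coeff_0_on_line)
qed

text \<open>The directional derivatives along the basis vectors are the partial derivatives, so all
  directional derivatives vanish exactly when all partial ones do. Points off the curve are covered
  by the coefficient of 1.\<close>

lemma nonsingular_plane_curve_altdef:
  "nonsingular_plane_curve d F \<longleftrightarrow> F \<noteq> 0 \<and> homogeneous d F \<and>
    (\<forall>v::'k::field^3. v \<noteq> 0 \<longrightarrow> (\<exists>w. Polynomial.coeff (on_line F v w) 0 \<noteq> 0 \<or> Polynomial.coeff (on_line F v w) 1 \<noteq> 0))"
proof -
  have "(\<forall>w. Polynomial.coeff (on_line F v w) 1 = 0) \<longleftrightarrow> (\<forall>i. poly3_eval (partial_deriv i F) v = 0)"
    for v :: "'k^3"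
  proof
    assume *: "\<forall>w. Polynomial.coeff (on_line F v w) 1 = 0"
    show "\<forall>i. poly3_eval (partial_deriv i F) v = 0"
    proof
      fix i
      show "poly3_eval (partial_deriv i F) v = 0"
        using *[rule_format, of "axis i 1"] unfolding coeff_1_on_line
        by (simp add: axis_def if_distrib[of "\<lambda>x. x * _"] cong: if_cong)
    qed
  qed (simp add: coeff_1_on_line del: One_nat_def)
  then show ?thesis
    unfolding nonsingular_plane_curve_def coeff_0_on_line by blast
qed

section \<open>Monomial matrices\<close>

text \<open>Indexing by rows makes the substitution send \<open>Var i\<close> to a multiple of
  \<open>Var (\<pi> i)\<close>. Basis vectors then move by the inverse of \<open>\<pi>\<close>,
  which is why a rotation of them by \<open>r\<close> appears later as
  \<open>\<lambda>l. l - r\<close>.\<close>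

definition monomial_matrix :: "('n \<Rightarrow> 'k::zero) \<Rightarrow> ('n \<Rightarrow> 'n) \<Rightarrow> 'k^'n^'n" where
  "monomial_matrix s \<pi> = (\<chi> i j. if j = \<pi> i then s i else 0)"

lemma monomial_matrix_mult_vec [simp]:
  "(monomial_matrix s \<pi> *v v) $ i = s i * (v :: 'k::semiring_1^'n) $ \<pi> i"
  by (simp add: monomial_matrix_def matrix_vector_mult_def if_distrib[of "\<lambda>x. x * _"] cong: if_cong)

lemma monomial_matrix_mult:
  "monomial_matrix s \<pi> ** monomial_matrix s' \<pi>' =
    (monomial_matrix (\<lambda>i. s i * s' (\<pi> i)) (\<pi>' \<circ> \<pi>) :: 'k::semiring_1^'n^'n)"
  by (simp add: monomial_matrix_def matrix_matrix_mult_def vec_eq_iff if_distrib[of "\<lambda>x. x * _"]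
      cong: if_cong)

lemma invertible_monomial_matrix:
  fixes s :: "'n::finite \<Rightarrow> 'k::field"
  assumes "bij \<pi>" "\<And>i. s i \<noteq> 0"
  shows "invertible (monomial_matrix s \<pi>)"
  unfolding invertible_left_inverse matrix_left_invertible_ker
proof (intro allI impI)
  fix v :: "'k^'n" assume *: "monomial_matrix s \<pi> *v v = 0"
  have "s i * v $ \<pi> i = 0" for i
    using * by (metis monomial_matrix_mult_vec zero_index)
  then have "v $ \<pi> i = 0" for i
    using assms(2)[of i] by (metis mult_eq_0_iff)
  then show "v = 0"
    using assms(1) by (metis bij_is_surj surjD vec_eq_iff zero_index)
qed

lemma linear_form_monomial_matrix:
  "linear_form (monomial_matrix s \<pi>) i = Const (s i) * Var (\<pi> i)"
  by (simp add: linear_form_def monomial_matrix_def if_distrib[of Const] if_distrib[of "\<lambda>x. x * _"]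
      cong: if_cong)

text \<open>Monomials are eigenvectors of a diagonal substitution. Hence all monomials of a form
  that is preserved up to a factor have that factor as their weight.\<close>

lemma lookup_linear_subst_diagonal:
  fixes F :: "'k::comm_semiring_1 poly3"
  shows "Poly_Mapping.lookup (linear_subst (monomial_matrix t id) F) m =
    (\<Prod>i\<in>UNIV. t i ^ Poly_Mapping.lookup m i) * Poly_Mapping.lookup F m"
proof -
  have "linear_form (monomial_matrix t id) i =
      Poly_Mapping.single (Poly_Mapping.single i 1) (t i)" for i :: 3
    by (simp add: linear_form_monomial_matrix Const_def Var_def mult_single)
  moreover have "Poly_Mapping.single (Poly_Mapping.single i 1) (t i) ^ n =
      Poly_Mapping.single (Poly_Mapping.single i n) (t i ^ n)" for i n
    by (induction n) (simp_all add: mult_single flip: single_add)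
  moreover have "Poly_Mapping.single 1 (Poly_Mapping.lookup m 1) +
      (Poly_Mapping.single 2 (Poly_Mapping.lookup m 2) +
       Poly_Mapping.single 3 (Poly_Mapping.lookup m 3)) = m" for m :: "3 \<Rightarrow>\<^sub>0 nat"
  proof (rule poly_mapping_eqI)
    fix k :: 3
    show "Poly_Mapping.lookup (Poly_Mapping.single 1 (Poly_Mapping.lookup m 1) +
        (Poly_Mapping.single 2 (Poly_Mapping.lookup m 2) +
         Poly_Mapping.single 3 (Poly_Mapping.lookup m 3))) k = Poly_Mapping.lookup m k"
      using exhaust_3[of k] by (auto simp: lookup_add lookup_single when_def)
  qed
  ultimately have "linear_subst (monomial_matrix t id) F =
      (\<Sum>m\<in>Poly_Mapping.keys F. Poly_Mapping.single m
        (Poly_Mapping.lookup F m * (\<Prod>i\<in>UNIV. t i ^ Poly_Mapping.lookup m i)))"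
    by (simp add: linear_subst_def insertion_def prod_UNIV_3 mult_single Const_def)
  then show ?thesis
    by (simp add: lookup_sum lookup_single when_def in_keys_iff mult.commute)
qed

section \<open>Degree and smoothness under changes of coordinates\<close>

lemma homogeneous_linear_subst:
  assumes "homogeneous d F"
  shows "homogeneous d (linear_subst A F)"
proof -
  have mult: "homogeneous (a + b) (p * q)" if "homogeneous a p" "homogeneous b q"
    for a b and p q :: "'a poly3"
    using that Poly_Mapping.keys_mult[of p q]
    by (fastforce simp: homogeneous_def lookup_add sum.distrib)
  have sum: "homogeneous a (sum p I)" if "\<And>i. i \<in> I \<Longrightarrow> homogeneous a (p i)"
    for a and p :: "'b \<Rightarrow> 'a poly3" and I
    using that Poly_Mapping.keys_sum[of p I] unfolding homogeneous_def by blast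
  have const: "homogeneous 0 (Const c)" for c :: 'a
    by (simp add: homogeneous_def Const_def)
  have var: "homogeneous 1 (Var i :: 'a poly3)" for i
    by (simp add: homogeneous_def Var_def lookup_single when_def)
  have form: "homogeneous 1 (linear_form A i)" for i
    unfolding linear_form_def by (intro sum) (use mult[OF const var] in simp)
  have one: "homogeneous 0 (1 :: 'a poly3)"
    using const[of 1] by simp
  have power: "homogeneous n (linear_form A i ^ n)" for i n
    using mult[OF form] one by (induction n) simp_all
  \<comment> \<open>The sum is nested like the coefficient times the product of three powers, so
    that \<open>mult\<close> applies factor by factor.\<close>
  have "homogeneous (0 + (Poly_Mapping.lookup m 1 + (Poly_Mapping.lookup m 2 + Poly_Mapping.lookup m 3)))
      (Const c * (\<Prod>i\<in>UNIV. linear_form A i ^ Poly_Mapping.lookup m i))" for m c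
    unfolding prod_UNIV_3 by (intro mult const power)
  moreover have "0 + (Poly_Mapping.lookup m 1 + (Poly_Mapping.lookup m 2 + Poly_Mapping.lookup m 3)) = d"
    if "m \<in> Poly_Mapping.keys F" for m
    using assms that by (simp add: homogeneous_def sum_3 add.assoc)
  ultimately show ?thesis
    unfolding linear_subst_def insertion_def by (intro sum) metis
qed

lemma nonsingular_plane_curve_linear_subst:
  fixes F :: "'k::field poly3"
  assumes "nonsingular_plane_curve d F" "invertible A"
  shows "nonsingular_plane_curve d (linear_subst A F)"
proof -
  obtain B where B: "A ** B = mat 1" "B ** A = mat 1"
    using assms(2) by (auto simp: invertible_def)
  have "linear_subst B (linear_subst A F) = F"
    by (simp add: linear_subst_linear_subst B linear_subst_one_matrix)
  then have "linear_subst A F \<noteq> 0"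
    using assms(1) by (auto simp: nonsingular_plane_curve_def linear_subst_def)
  moreover have "\<exists>w. Polynomial.coeff (on_line (linear_subst A F) v w) 0 \<noteq> 0 \<or>
      Polynomial.coeff (on_line (linear_subst A F) v w) 1 \<noteq> 0" if "v \<noteq> 0" for v
  proof -
    have "B *v (A *v v) = v" by (simp add: matrix_vector_mul_assoc B)
    then have "A *v v \<noteq> 0" using that by (metis matrix_vector_mult_0_right)
    then obtain w where "Polynomial.coeff (on_line F (A *v v) w) 0 \<noteq> 0 \<or> Polynomial.coeff (on_line F (A *v v) w) 1 \<noteq> 0"
      using assms(1) unfolding nonsingular_plane_curve_altdef by blast
    moreover have "A *v (B *v w) = w" by (simp add: matrix_vector_mul_assoc B)
    ultimately show ?thesis
      by (metis on_line_linear_subst)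
  qed
  ultimately show ?thesis
    using assms(1) homogeneous_linear_subst unfolding nonsingular_plane_curve_altdef by blast
qed

text \<open>
  In the expansion of \<open>F (e\<^sub>i + t w)\<close> only the monomials \<open>X\<^sub>i\<^sup>d\<^sup>-\<^sup>1 X\<^sub>j\<close> contribute to the coefficients
  of \<open>1\<close> and \<open>t\<close>.
\<close>

lemma nonsingular_plane_curve_monomial:
  fixes F :: "'k::field poly3"
  assumes "nonsingular_plane_curve d F" "d \<ge> 1"
  shows "\<exists>j. Poly_Mapping.single i (d - 1) + Poly_Mapping.single j 1 \<in> Poly_Mapping.keys F"
proof -
  have "(axis i 1 :: 'k^3) \<noteq> 0" by simp
  then obtain w k where w: "Polynomial.coeff (on_line F (axis i 1) w) k \<noteq> 0" "k \<le> 1"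
    using assms(1) unfolding nonsingular_plane_curve_altdef by (metis le_numeral_extra(4) zero_le_one)
  let ?P = "\<lambda>m. \<Prod>l\<in>UNIV. [:(axis i 1 :: 'k^3) $ l, w $ l:] ^ Poly_Mapping.lookup m l"
  have "Polynomial.coeff (on_line F (axis i 1) w) k =
      (\<Sum>m\<in>Poly_Mapping.keys F. Poly_Mapping.lookup F m * Polynomial.coeff (?P m) k)"
    by (simp add: on_line_def insertion_def coeff_sum)
  then obtain m where m: "m \<in> Poly_Mapping.keys F" "Polynomial.coeff (?P m) k \<noteq> 0"
    using w(1) by (metis (no_types, lifting) mult_zero_right sum.neutral)
  let ?l = "Poly_Mapping.lookup m"
  \<comment> \<open>Every factor with index other than \<open>i\<close> is a multiple of
    \<open>t\<close>, so \<open>t ^ q\<close> divides the monomial on the line. A non-zero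
    coefficient of 1 or \<open>t\<close> therefore forces \<open>q \<le> 1\<close>.\<close>
  define q where "q = (\<Sum>l\<in>UNIV - {i}. ?l l)"
  have deg: "?l i + q = d"
    using assms(1) m(1) sum.remove[of UNIV i ?l]
    by (auto simp: nonsingular_plane_curve_def homogeneous_def q_def)
  have "[:0, 1:] ^ q = (\<Prod>l\<in>UNIV - {i}. [:0, 1:] ^ ?l l :: 'k poly)"
    by (simp add: q_def power_sum)
  also have "\<dots> dvd (\<Prod>l\<in>UNIV - {i}. [:(axis i 1 :: 'k^3) $ l, w $ l:] ^ ?l l)"
  proof (rule prod_dvd_prod)
    fix l assume "l \<in> UNIV - {i}"
    then have "[:(axis i 1 :: 'k^3) $ l, w $ l:] = [:0, 1:] * [:w $ l:]"
      by (simp add: axis_def)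
    then show "[:0, 1:] ^ ?l l dvd [:(axis i 1 :: 'k^3) $ l, w $ l:] ^ ?l l"
      by (metis dvd_triv_left dvd_power_same)
  qed
  also have "\<dots> dvd ?P m"
    by (rule prod_dvd_prod_subset) auto
  finally have "Polynomial.monom 1 q dvd ?P m"
    by (simp add: monom_altdef)
  then have "Polynomial.coeff (?P m) k = 0" if "k < q"
    using that unfolding monom_1_dvd_iff' by blast
  then have "q \<le> k"
    using m(2) by (meson not_less)
  then have "q \<le> 1" using w(2) by simp
  have "\<exists>j. m = Poly_Mapping.single i (d - 1) + Poly_Mapping.single j 1"
  proof (cases "\<exists>j. j \<noteq> i \<and> ?l j \<noteq> 0")
    case False
    then have "q = 0" unfolding q_def by (intro sum.neutral) auto
    then have "m = Poly_Mapping.single i (d - 1) + Poly_Mapping.single i 1"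
      using False deg assms(2)
      by (intro poly_mapping_eqI) (auto simp: lookup_add lookup_single when_def)
    then show ?thesis by blast
  next
    case True
    then obtain j where j: "j \<noteq> i" "?l j \<noteq> 0" by blast
    have "q = ?l j + (\<Sum>l\<in>UNIV - {i} - {j}. ?l l)"
      unfolding q_def using j(1) by (subst sum.remove[of _ j]) auto
    then have "q = 1" "?l j = 1" and rest: "(\<Sum>l\<in>UNIV - {i} - {j}. ?l l) = 0"
      using j(2) \<open>q \<le> 1\<close> by linarith+
    moreover have "?l l = 0" if "l \<noteq> i" "l \<noteq> j" for l
      using rest that by (simp add: sum_eq_0_iff)
    ultimately have "m = Poly_Mapping.single i (d - 1) + Poly_Mapping.single j 1"
      using deg j(1) by (intro poly_mapping_eqI) (auto simp: lookup_add lookup_single when_def)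
    then show ?thesis by blast
  qed
  then show ?thesis using m(1) by auto
qed

section \<open>Diagonalization\<close>

text \<open>The derivative of \<open>X ^ n - c\<close> vanishes at most at 0, which is not a root.
  So the polynomial has no multiple roots, and it splits into \<open>n\<close> linear
  factors.\<close>

lemma card_nth_roots_alg_closed:
  fixes c :: "'k::{alg_closed_field, field_char_0}"
  assumes "n > 0" "c \<noteq> 0"
  shows "card {r. r ^ n = c} = n"
proof -
  define p where "p = Polynomial.monom 1 n - [:c:]"
  have poly_p: "poly p r = r ^ n - c" for r
    by (simp add: p_def poly_monom)
  have "degree p = n"
    unfolding p_def diff_conv_add_uminus using assms
    by (subst degree_add_eq_left) (simp_all add: degree_monom_eq)
  then have "p \<noteq> 0" using assms by auto
  obtain A where A: "size A = degree p" "p = Polynomial.smult (lead_coeff p) (\<Prod>x\<in>#A. [:-x, 1:])"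
    using alg_closed_imp_factorization[OF \<open>p \<noteq> 0\<close>] by blast
  have "proots (\<Prod>x\<in>#A. [:-x, 1:]) = A"
    by (induction A) (simp_all add: proots_mult prod_mset_zero_iff image_iff del: mult_pCons_left)
  then have "proots p = A"
    by (subst A(2)) (use \<open>p \<noteq> 0\<close> in simp)
  moreover have "rsquarefree p"
    unfolding rsquarefree_roots using assms
    by (auto simp: p_def poly_monom pderiv_diff pderiv_monom pderiv_pCons)
  then have "count (proots p) r = 1" if "r \<in># proots p" for r
    using that \<open>p \<noteq> 0\<close> unfolding rsquarefree_def
    by (metis One_nat_def count_greater_zero_iff count_proots less_irrefl)
  then have "size (proots p) = card (set_mset (proots p))"
    by (simp add: size_multiset_overloaded_eq)
  moreover have "set_mset (proots p) = {r. r ^ n = c}"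
    using \<open>p \<noteq> 0\<close> by (simp add: poly_p)
  ultimately show ?thesis
    using A(1) \<open>degree p = n\<close> by simp
qed

text \<open>Multiplying the roots by an \<open>n\<close>-th root of unity \<open>u\<close> permutes
  them and multiplies the sum by \<open>u ^ k\<close>. Some \<open>u\<close> has
  \<open>u ^ k \<noteq> 1\<close>, because only \<open>k < n\<close> elements satisfy
  \<open>u ^ k = 1\<close>.\<close>

lemma sum_nth_roots_power_eq_0:
  fixes c :: "'k::{alg_closed_field, field_char_0}"
  assumes "c \<noteq> 0" "0 < k" "k < n"
  shows "(\<Sum>r | r ^ n = c. r ^ k) = 0"
proof -
  have fin: "finite {r::'k. r ^ m = 1}" if "m > 0" for m
    using card_nth_roots_alg_closed[of m "1::'k"] that by (intro card_ge_0_finite) simp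
  have "\<exists>u::'k. u ^ n = 1 \<and> u ^ k \<noteq> 1"
  proof (rule ccontr)
    assume "\<not> ?thesis"
    then have "card {u::'k. u ^ n = 1} \<le> card {u::'k. u ^ k = 1}"
      by (intro card_mono fin) (use assms in auto)
    then show False
      using assms by (simp add: card_nth_roots_alg_closed)
  qed
  then obtain u :: 'k where u: "u ^ n = 1" "u ^ k \<noteq> 1" by blast
  then have "u \<noteq> 0" using assms by (auto simp: power_0_left)
  have "(\<Sum>r | r ^ n = c. r ^ k) = (\<Sum>r | r ^ n = c. (u * r) ^ k)"
    by (rule sum.reindex_bij_witness[of _ "\<lambda>r. u * r" "\<lambda>r. r / u"])
      (use u \<open>u \<noteq> 0\<close> in \<open>auto simp: power_mult_distrib power_divide\<close>)
  also have "\<dots> = u ^ k * (\<Sum>r | r ^ n = c. r ^ k)"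
    by (simp add: power_mult_distrib sum_distrib_left)
  finally have "(1 - u ^ k) * (\<Sum>r | r ^ n = c. r ^ k) = 0"
    by (simp add: left_diff_distrib)
  then show ?thesis using u by simp
qed

text \<open>
  With \<open>r\<close> ranging over the \<open>n\<close>-th roots of \<open>1 / c\<close>, the vectors \<open>\<Sum>k<n. r\<^sup>k A\<^sup>k v\<close> are
  eigenvectors or zero, and they add up to \<open>n v\<close>. Hence the eigenvectors span.
\<close>

lemma diagonalizable_if_power_scalar:
  fixes A :: "'k::{alg_closed_field, field_char_0}^'n^'n"
  assumes "n > 0" "c \<noteq> 0" and pow: "\<And>v. ((*v) A ^^ n) v = c *s v"
  shows "\<exists>(P::'k^'n^'n) t. invertible P \<and> A ** P = P ** monomial_matrix t id"
proof -
  define E where "E = {v. \<exists>t. A *v v = t *s v}"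
  have "v \<in> vec.span E" for v
  proof -
    define R where "R = {r. r ^ n = inverse c}"
    define w where "w = (\<lambda>r. \<Sum>k<n. r ^ k *s ((*v) A ^^ k) v)"
    have eigen: "w r \<in> E" if "r \<in> R" for r
    proof -
      have "r \<noteq> 0" using that assms by (auto simp: R_def power_0_left)
      \<comment> \<open>Applying \<open>r A\<close> shifts the sum by one place; the new last term
        is \<open>r\<^sup>n A\<^sup>n v = v\<close>, which replaces the lost first term.\<close>
      have "r *s (A *v w r) = (\<Sum>k<n. r ^ Suc k *s ((*v) A ^^ Suc k) v)"
        by (simp add: w_def vec.linear_sum[OF matrix_vector_mul_linear_gen] vec.scale_sum_right
            matrix_vector_mult_scaleR vec.linear_scale[OF matrix_vector_mul_linear_gen])
      also have "\<dots> = (\<Sum>k<Suc n. r ^ k *s ((*v) A ^^ k) v) - v"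
        by (subst sum.lessThan_Suc_shift) simp
      also have "\<dots> = w r"
        using that assms by (simp add: w_def pow R_def)
      finally have "A *v w r = inverse r *s w r"
        using \<open>r \<noteq> 0\<close> by (metis vector_smult_assoc left_inverse vector_smult_lid)
      then show ?thesis by (auto simp: E_def)
    qed
    have card: "card R = n"
      unfolding R_def using assms by (intro card_nth_roots_alg_closed) auto
    have "(\<Sum>r\<in>R. w r) = (\<Sum>k<n. (\<Sum>r\<in>R. r ^ k) *s ((*v) A ^^ k) v)"
      unfolding w_def by (subst sum.swap) (simp add: vec.scale_sum_left)
    also have "\<dots> = (\<Sum>k\<in>{0}. (\<Sum>r\<in>R. r ^ k) *s ((*v) A ^^ k) v)"
      using assms unfolding R_def
      by (intro sum.mono_neutral_right) (auto simp: sum_nth_roots_power_eq_0)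
    also have "\<dots> = of_nat n *s v"
      by (simp add: card)
    finally have "v = inverse (of_nat n) *s (\<Sum>r\<in>R. w r)"
      using assms by (simp add: vector_smult_assoc)
    moreover have "(\<Sum>r\<in>R. w r) \<in> vec.span E"
      by (intro vec.span_sum vec.span_base eigen)
    ultimately show ?thesis
      by (metis vec.span_scale)
  qed
  then have span: "vec.span E = UNIV" by auto
  \<comment> \<open>A basis chosen inside the set of eigenvectors provides the columns of the
    diagonalizing matrix.\<close>
  obtain B where B: "B \<subseteq> E" "vec.independent B" "E \<subseteq> vec.span B" "card B = vec.dim E"
    using vec.basis_exists by blast
  have "vec.span B = UNIV"
    using vec.span_mono[OF B(3)] by (simp add: span vec.span_span top.extremum_unique)
  have "card B = CARD('n)"
    using B(4) vec.dim_span[of E] vec_dim_card[where 'a = 'k and 'n = 'n] by (metis span)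
  then have "finite B" by (intro card_ge_0_finite) simp
  then obtain f :: "'n \<Rightarrow> 'k^'n" where f: "bij_betw f UNIV B"
    using \<open>card B = CARD('n)\<close> finite_same_card_bij[of "UNIV :: 'n set" B] by auto
  define P where "P = (\<chi> i j. f j $ i)"
  have col: "column j P = f j" for j
    by (simp add: column_def P_def vec_eq_iff)
  then have "columns P = B"
    using f by (auto simp: columns_def bij_betw_def)
  then have inv: "invertible P"
    using \<open>vec.span B = UNIV\<close> by (simp add: invertible_right_inverse matrix_right_invertible_span_columns)
  have "\<forall>j. \<exists>t. A *v f j = t *s f j"
    using f B(1) by (auto simp: bij_betw_def E_def)
  then obtain t where t: "\<And>j. A *v f j = t j *s f j" by metis
  have "(A ** P) $ i $ j = (P ** monomial_matrix t id) $ i $ j" for i j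
  proof -
    have "(A ** P) $ i $ j = (A *v f j) $ i"
      by (simp add: matrix_matrix_mult_def matrix_vector_mult_def P_def)
    also have "\<dots> = (P ** monomial_matrix t id) $ i $ j"
      by (simp add: t matrix_matrix_mult_def P_def monomial_matrix_def if_distrib[of "\<lambda>x. _ * x"] mult.commute cong: if_cong)
    finally show ?thesis .
  qed
  then have "A ** P = P ** monomial_matrix t id"
    by (simp add: vec_eq_iff)
  then show ?thesis using inv by (intro exI[of _ P] exI[of _ t]) simp
qed

section \<open>Weights of monomials\<close>

text \<open>The numbers \<open>d\<close>, \<open>d - 1\<close> and \<open>(d - 1) * (d - 2)\<close>
  are positive and less than \<open>n\<close>; the other three lie strictly between \<open>n\<close>
  and \<open>2 * n\<close>.\<close>

lemma order_numbers_not_dvd: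
  fixes d :: nat
  assumes "d \<ge> 4"
  shows "\<not> (d\<^sup>2 - 3 * d + 3) dvd d" "\<not> (d\<^sup>2 - 3 * d + 3) dvd (d - 1)"
    "\<not> (d\<^sup>2 - 3 * d + 3) dvd d * (d - 1)" "\<not> (d\<^sup>2 - 3 * d + 3) dvd (d - 1) * (d - 1)"
    "\<not> (d\<^sup>2 - 3 * d + 3) dvd d * (d - 2)" "\<not> (d\<^sup>2 - 3 * d + 3) dvd (d - 1) * (d - 2)"
proof -
  define e where "e = d - 4"
  have d: "d = e + 4" using assms by (simp add: e_def)
  define n where "n = d\<^sup>2 - 3 * d + 3"
  have n: "n = e * e + 5 * e + 7"
    by (simp add: n_def d power2_eq_square algebra_simps)
  show "\<not> (d\<^sup>2 - 3 * d + 3) dvd d" "\<not> (d\<^sup>2 - 3 * d + 3) dvd (d - 1)"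
    "\<not> (d\<^sup>2 - 3 * d + 3) dvd (d - 1) * (d - 2)"
    unfolding n_def[symmetric]
    by (intro nat_dvd_not_less; simp add: n d algebra_simps)+
  have "d * (d - 1) = n + (2 * e + 5)" "(d - 1) * (d - 1) = n + (e + 2)" "d * (d - 2) = n + (e + 1)"
    by (simp_all add: n d algebra_simps)
  then show "\<not> (d\<^sup>2 - 3 * d + 3) dvd d * (d - 1)" "\<not> (d\<^sup>2 - 3 * d + 3) dvd (d - 1) * (d - 1)"
    "\<not> (d\<^sup>2 - 3 * d + 3) dvd d * (d - 2)"
    unfolding n_def[symmetric]
    by (simp_all only: dvd_add_right_iff[OF dvd_refl])
      (intro nat_dvd_not_less; simp add: n)+
qed

text \<open>
  The last hypothesis says that the monomials \<open>X\<^sub>i\<^sup>d\<^sup>-\<^sup>1 X\<^sub>j\<close> with \<open>j = j(i)\<close> have the same weight under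
  the diagonal matrix \<open>t\<close>. Unless \<open>j\<close> is a 3-cycle, the order of \<open>t\<close> modulo scalars divides
  one of \<open>d\<close>, \<open>d - 1\<close>, \<open>d (d - 1)\<close>, \<open>(d - 1)\<^sup>2\<close>, \<open>d (d - 2)\<close> and \<open>(d - 1) (d - 2)\<close>.
\<close>

lemma equal_weights_imp_cycle:
  fixes t :: "3 \<Rightarrow> 'k::field" and d :: nat
  assumes d: "d \<ge> 4"
    and nz: "\<And>i. t i \<noteq> 0"
    and ord: "\<And>k. (\<forall>i j. t i ^ k = t j ^ k) \<Longrightarrow> d\<^sup>2 - 3 * d + 3 dvd k"
    and weight: "\<And>i. t i ^ (d - 1) * t (j i) = c"
  shows "j 1 = 2 \<and> j 2 = 3 \<and> j 3 = 1 \<or> j 1 = 3 \<and> j 2 = 1 \<and> j 3 = 2"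
proof -
  define N where "N = d - 2"
  have N: "d = Suc (Suc N)" using d by (simp add: N_def)
  have no_order: False if "{a, b, e} = UNIV" "t a ^ k = t b ^ k" "t b ^ k = t e ^ k"
    "k \<in> {d, d - 1, d * (d - 1), (d - 1) * (d - 1), d * (d - 2), (d - 1) * (d - 2)}" for a b e k
  proof -
    have "t i ^ k = t a ^ k" for i
    proof -
      have "i \<in> {a, b, e}" using that(1) by simp
      then show ?thesis using that by auto
    qed
    then have "d\<^sup>2 - 3 * d + 3 dvd k" by (intro ord) metis
    then show False using that(4) order_numbers_not_dvd[OF d] by auto
  qed
  \<comment> \<open>Up to relabelling, a self-map of three points other than a 3-cycle has one of
    six shapes. Each is refuted with its own exponent from the list in
    \<open>no_order\<close>.\<close>
  have three_fixed: False if "{a, b, e} = UNIV" "j a = a" "j b = b" "j e = e" for a b e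
  proof (rule no_order[OF that(1)])
    show "t a ^ d = t b ^ d" "t b ^ d = t e ^ d"
      using weight[of a] weight[of b] weight[of e] that by (simp_all add: N mult.commute)
  qed simp
  have two_fixed: False if "{a, b, e} = UNIV" "j a = a" "j b = b" "j e = a" for a b e
  proof (rule no_order[OF that(1)])
    have "t a ^ d = t b ^ d" "t e ^ (d - 1) = t a ^ (d - 1)"
      using weight[of a] weight[of b] weight[of e] that nz[of a] by (auto simp: N mult.commute)
    then show "t a ^ (d * (d - 1)) = t b ^ (d * (d - 1))" "t b ^ (d * (d - 1)) = t e ^ (d * (d - 1))"
      by (metis power_mult mult.commute)+
  qed simp
  have star: False if "{a, b, e} = UNIV" "j a = a" "j b = a" "j e = a" for a b e
  proof (rule no_order[OF that(1)])
    show "t a ^ (d - 1) = t b ^ (d - 1)" "t b ^ (d - 1) = t e ^ (d - 1)"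
      using weight[of a] weight[of b] weight[of e] that nz[of a] by (metis mult_right_cancel)+
  qed simp
  have chain: False if "{a, b, e} = UNIV" "j a = a" "j b = a" "j e = b" for a b e
  proof (rule no_order[OF that(1)])
    have ab: "t a ^ (d - 1) = t b ^ (d - 1)"
      using weight[of a] weight[of b] that nz[of a] by (metis mult_right_cancel)
    then show "t a ^ ((d - 1) * (d - 1)) = t b ^ ((d - 1) * (d - 1))"
      by (simp add: power_mult)
    have "t e ^ (d - 1) * t b = t b ^ (d - 1) * t a"
      using weight[of b] weight[of e] that by simp
    \<comment> \<open>Raising to the power \<open>d - 1\<close> turns the single factors
      \<open>t b\<close> and \<open>t a\<close> into equal powers, which cancel.\<close>
    then have "(t e ^ (d - 1)) ^ (d - 1) * t b ^ (d - 1) = (t b ^ (d - 1)) ^ (d - 1) * t a ^ (d - 1)"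
      by (metis power_mult_distrib)
    then show "t b ^ ((d - 1) * (d - 1)) = t e ^ ((d - 1) * (d - 1))"
      using ab nz[of b] by (simp add: power_mult)
  qed simp
  have point_and_swap: False if "{a, b, e} = UNIV" "j a = a" "j b = e" "j e = b" for a b e
  proof (rule no_order[OF that(1)])
    have "t b ^ N * (t b * t e) = t e ^ N * (t b * t e)"
      using weight[of b] weight[of e] that by (simp add: N mult_ac)
    then have be: "t b ^ N = t e ^ N" using nz by simp
    then show "t b ^ (d * (d - 2)) = t e ^ (d * (d - 2))"
      by (simp add: N power_mult mult.commute[of _ N] del: mult_Suc mult_Suc_right)
    have "t a ^ d = t b ^ N * (t b * t e)"
      using weight[of a] weight[of b] that by (simp add: N mult_ac)
    \<comment> \<open>The power \<open>N\<close> turns the stray factor \<open>t e\<close> into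
      \<open>t e ^ N\<close>, which equals \<open>t b ^ N\<close>.\<close>
    then have "(t a ^ d) ^ N = (t b ^ N) ^ N * (t b ^ N * t e ^ N)"
      by (simp add: power_mult_distrib)
    also have "\<dots> = (t b ^ N) ^ d" by (simp add: be N mult_ac)
    also have "\<dots> = (t b ^ d) ^ N" by (simp add: mult.commute flip: power_mult)
    finally show "t a ^ (d * (d - 2)) = t b ^ (d * (d - 2))"
      by (simp add: N power_mult del: mult_Suc mult_Suc_right power_Suc)
  qed simp
  have swap_and_leaf: False if "{a, b, e} = UNIV" "j a = b" "j b = a" "j e = a" for a b e
  proof (rule no_order[OF that(1)])
    have "t a ^ N * (t a * t b) = t b ^ N * (t a * t b)"
      using weight[of a] weight[of b] that by (simp add: N mult_ac)
    then have "t a ^ N = t b ^ N" using nz by simp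
    then show "t a ^ ((d - 1) * (d - 2)) = t b ^ ((d - 1) * (d - 2))"
      by (simp add: N power_mult mult.commute[of _ N] del: mult_Suc mult_Suc_right)
    have "t b ^ (d - 1) = t e ^ (d - 1)"
      using weight[of b] weight[of e] that nz[of a] by (metis mult_right_cancel)
    then show "t b ^ ((d - 1) * (d - 2)) = t e ^ ((d - 1) * (d - 2))"
      by (simp add: power_mult)
  qed simp
  \<comment> \<open>With all orders of the three indices, the six shapes account for 25 of the 27
    self-maps and leave the two 3-cycles.\<close>
  have "{1, 2, 3} = (UNIV :: 3 set)" "{1, 3, 2} = (UNIV :: 3 set)" "{2, 1, 3} = (UNIV :: 3 set)"
    "{2, 3, 1} = (UNIV :: 3 set)" "{3, 1, 2} = (UNIV :: 3 set)" "{3, 2, 1} = (UNIV :: 3 set)"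
    by (auto simp: UNIV_3)
  note excluded = this[THEN three_fixed] this[THEN two_fixed] this[THEN star] this[THEN chain]
    this[THEN point_and_swap] this[THEN swap_and_leaf]
  show ?thesis
    using exhaust_3[of "j 1"] exhaust_3[of "j 2"] exhaust_3[of "j 3"]
    by (elim disjE) (use excluded in simp_all)
qed

section \<open>Weights on a 3-cycle\<close>

text \<open>Since \<open>a\<close> and \<open>b\<close> are at most \<open>d\<close>, the right-hand
  side of \<open>dvd\<close> lies strictly between \<open>- 2 n\<close> and \<open>n\<close>, so it
  is 0 or \<open>- n\<close>. The value 0 leaves the first and the third triple, the value
  \<open>- n\<close> the second.\<close>

lemma klein_weight_exponents:
  fixes a b e d :: nat
  assumes d: "d \<ge> 4" "a + b + e = d"
    and dvd: "int (d\<^sup>2 - 3 * d + 3) dvd int a - 1 - int (d - 2) * int b"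
  shows "(a, b, e) \<in> {(d - 1, 1, 0), (0, d - 1, 1), (1, 0, d - 1)}"
proof -
  define N where "N = d - 2"
  have N: "d = N + 2" "N \<ge> 2" using d by (auto simp: N_def)
  have n: "d\<^sup>2 - 3 * d + 3 = N * N + N + 1"
    using N(2) by (cases N) (simp_all add: N power2_eq_square algebra_simps)
  obtain q where q: "int a - 1 - int N * int b = (int N * int N + int N + 1) * q"
    using dvd unfolding n N_def[symmetric] by (auto elim!: dvdE simp: algebra_simps)
  let ?n = "int N * int N + int N + 1"
  have ab: "a \<le> N + 2" "b \<le> N + 2" using d N by auto
  have "int N * int b \<le> int N * (int N + 2)" using ab by (intro mult_left_mono) auto
  then have "?n * q > ?n * (- 2)"
    unfolding q[symmetric] using N(2) mult_mono[of 2 "int N" 2 "int N"] by (simp add: algebra_simps)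
  then have "q > - 2" by (subst (asm) mult_less_cancel_left_pos) auto
  have "int N * int N \<ge> 2 * int N" using N(2) by (intro mult_right_mono) auto
  then have "?n * q < ?n * 1"
    unfolding q[symmetric] using N(2) ab(1) by (smt (verit) mult_nonneg_nonneg of_nat_0_le_iff of_nat_add of_nat_le_iff of_nat_numeral)
  then have "q < 1" by (subst (asm) mult_less_cancel_left_pos) auto
  with \<open>q > - 2\<close> consider "q = 0" | "q = - 1" by linarith
  then show ?thesis
  proof cases
    case 1
    then have "int a = int (1 + N * b)" using q by simp
    then have a: "a = 1 + N * b" by (simp only: of_nat_eq_iff)
    have "b \<le> 1"
    proof (rule ccontr)
      assume "\<not> b \<le> 1"
      then have "N * 2 \<le> N * b" by (intro mult_left_mono) auto
      then show False using a d(2) N \<open>\<not> b \<le> 1\<close> by linarith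
    qed
    then have "b = 0 \<or> b = 1" by auto
    then show ?thesis using a d N by auto
  next
    case 2
    then have "int (a + N * (N + 1)) = int (N * b)" using q by (simp add: algebra_simps)
    then have a: "a + N * (N + 1) = N * b" by (simp only: of_nat_eq_iff)
    have "N + 1 \<le> b"
      using mult_le_cancel1[of N "N + 1" b] a N(2) by linarith
    moreover have "b \<noteq> N + 2"
    proof
      assume "b = N + 2"
      then show False using a d N by (simp add: algebra_simps)
    qed
    ultimately have "b = N + 1" using ab by simp
    then show ?thesis using a d N by auto
  qed
qed

text \<open>Put \<open>N = d - 2\<close>, \<open>x = p / r\<close> and \<open>y = q / r\<close>. The
  weights give \<open>x ^ N * y = 1\<close> and \<open>y ^ (N + 1) = x\<close>; raising the first
  equation to the power \<open>N + 1\<close> eliminates \<open>y\<close>.\<close>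

lemma klein_weight_ratios:
  fixes p q r :: "'k::field" and d :: nat
  assumes d: "d \<ge> 4" and nz: "p \<noteq> 0" "q \<noteq> 0" "r \<noteq> 0"
    and weights: "p ^ (d - 1) * q = c" "q ^ (d - 1) * r = c" "r ^ (d - 1) * p = c"
  shows "(p / r) ^ (d - 2) * (q / r) = 1" "(p / r) ^ (d\<^sup>2 - 3 * d + 3) = 1"
proof -
  define N where "N = d - 2"
  have N: "d = N + 2" using d by (simp add: N_def)
  have n: "d\<^sup>2 - 3 * d + 3 = N * (N + 1) + 1"
    using d by (simp add: N power2_eq_square algebra_simps)
  define x y where "x = p / r" and "y = q / r"
  have nz': "x \<noteq> 0" "y \<noteq> 0" using nz by (auto simp: x_def y_def)
  have "p ^ (N + 1) * q = r ^ (N + 1) * p" "q ^ (N + 1) * r = r ^ (N + 1) * p"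
    using weights by (simp_all add: N)
  then have "x ^ (N + 1) * y = x" "y ^ (N + 1) = x"
    using nz by (simp_all add: x_def y_def field_simps)
  then have xy: "x ^ N * y = 1" "y ^ (N + 1) = x"
    using nz' by simp_all
  have "x ^ (N * (N + 1) + 1) = (x ^ N * y) ^ (N + 1)"
    by (simp only: power_mult power_mult_distrib power_add[of x "N * (N + 1)"] power_one_right xy(2))
  then show "(p / r) ^ (d\<^sup>2 - 3 * d + 3) = 1"
    by (simp only: xy(1) power_one n flip: x_def)
  show "(p / r) ^ (d - 2) * (q / r) = 1"
    using xy(1) by (simp add: x_def y_def N)
qed

text \<open>As \<open>q / r\<close> is the inverse of a power of \<open>p / r\<close>, the ratio
  \<open>p / r\<close> alone carries the order of the diagonal matrix modulo scalars. Expressing all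
  weights in this ratio turns their equality into a congruence of exponents modulo
  \<open>n\<close>.\<close>

lemma klein_weights:
  fixes p q r :: "'k::field" and d :: nat
  assumes d: "d \<ge> 4"
    and nz: "p \<noteq> 0" "q \<noteq> 0" "r \<noteq> 0"
    and ord: "\<And>k. p ^ k = q ^ k \<Longrightarrow> q ^ k = r ^ k \<Longrightarrow> d\<^sup>2 - 3 * d + 3 dvd k"
    and weights: "p ^ (d - 1) * q = c" "q ^ (d - 1) * r = c" "r ^ (d - 1) * p = c"
  shows "(p / r) ^ k = 1 \<longleftrightarrow> d\<^sup>2 - 3 * d + 3 dvd k"
    and "p ^ a * q ^ b * r ^ e = c \<Longrightarrow> a + b + e = d \<Longrightarrow>
      (a, b, e) \<in> {(d - 1, 1, 0), (0, d - 1, 1), (1, 0, d - 1)}"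
proof -
  define N where "N = d - 2"
  have N: "d = N + 2" using d by (simp add: N_def)
  have n: "d\<^sup>2 - 3 * d + 3 = N * (N + 1) + 1"
    using d by (simp add: N power2_eq_square algebra_simps)
  define x y where "x = p / r" and "y = q / r"
  have nz': "x \<noteq> 0" "y \<noteq> 0" using nz by (auto simp: x_def y_def)
  note ratios = klein_weight_ratios[OF d nz weights]
  have xy: "x ^ N * y = 1" using ratios(1) by (simp add: x_def y_def N)
  have xn: "x ^ (N * (N + 1) + 1) = 1" using ratios(2) by (simp only: n x_def)
  have ordx: "d\<^sup>2 - 3 * d + 3 dvd k" if "x ^ k = 1" for k
  proof (rule ord)
    have "(x ^ k) ^ N * y ^ k = (x ^ N * y) ^ k"
      by (simp add: power_mult_distrib mult.commute flip: power_mult)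
    then have "y ^ k = 1" using that by (simp add: xy)
    then have "q ^ k = r ^ k" "p ^ k = r ^ k"
      using nz that by (simp_all add: x_def y_def power_divide)
    then show "p ^ k = q ^ k" "q ^ k = r ^ k" by simp_all
  qed
  show "(p / r) ^ k = 1 \<longleftrightarrow> d\<^sup>2 - 3 * d + 3 dvd k"
  proof
    assume "(p / r) ^ k = 1"
    then show "d\<^sup>2 - 3 * d + 3 dvd k" by (intro ordx) (simp add: x_def)
  next
    assume "d\<^sup>2 - 3 * d + 3 dvd k"
    then show "(p / r) ^ k = 1"
      unfolding n by (metis dvdE power_mult power_one x_def xn)
  qed
  assume e: "p ^ a * q ^ b * r ^ e = c" "a + b + e = d"
  have pq: "p = x * r" "q = y * r" using nz by (simp_all add: x_def y_def)
  have "x ^ a * y ^ b * r ^ d = p ^ a * q ^ b * r ^ e"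
    by (simp add: pq power_mult_distrib power_add mult_ac flip: e(2))
  also have "\<dots> = r ^ (d - 1) * p" using e weights by simp
  also have "\<dots> = x * r ^ d" by (simp add: pq N)
  finally have "x ^ a * y ^ b * r ^ d = x * r ^ d" .
  then have "x ^ a * y ^ b = x" using nz by simp
  \<comment> \<open>Multiplication by \<open>x ^ (N * b)\<close> removes \<open>y\<close> without
    negative exponents.\<close>
  then have "x ^ a * (x ^ N * y) ^ b = x * x ^ (N * b)"
    by (simp add: power_mult_distrib power_mult mult_ac)
  then have eq: "x ^ a = x ^ (1 + N * b)" by (simp add: xy)
  have "int (d\<^sup>2 - 3 * d + 3) dvd int a - 1 - int N * int b"
  proof (cases "a \<ge> 1 + N * b")
    case True
    then have "x ^ (a - (1 + N * b)) = 1"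
      using eq nz' by (simp add: power_diff)
    then have "int (d\<^sup>2 - 3 * d + 3) dvd int (a - (1 + N * b))"
      unfolding of_nat_dvd_iff by (rule ordx)
    then show ?thesis using True by (simp add: of_nat_diff algebra_simps)
  next
    case False
    then have "x ^ ((1 + N * b) - a) = 1"
      using eq nz' by (simp add: power_diff)
    then have "int (d\<^sup>2 - 3 * d + 3) dvd - int (1 + N * b - a)"
      unfolding dvd_minus_iff of_nat_dvd_iff by (rule ordx)
    then show ?thesis using False by (simp add: of_nat_diff algebra_simps)
  qed
  then show "(a, b, e) \<in> {(d - 1, 1, 0), (0, d - 1, 1), (1, 0, d - 1)}"
    using klein_weight_exponents[OF d e(2)] by (simp add: N_def)
qed

lemma klein_scaling:
  fixes \<alpha> \<beta> \<gamma> :: "'k::alg_closed_field"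
  assumes "d \<ge> 4" and nz: "\<alpha> \<noteq> 0" "\<beta> \<noteq> 0" "\<gamma> \<noteq> 0"
  shows "\<exists>x y z \<kappa>. x \<noteq> 0 \<and> y \<noteq> 0 \<and> z \<noteq> 0 \<and> \<kappa> \<noteq> 0 \<and> \<alpha> * (x ^ (d - 1) * y) = \<kappa> \<and>
    \<beta> * (y ^ (d - 1) * z) = \<kappa> \<and> \<gamma> * (z ^ (d - 1) * x) = \<kappa>"
proof -
  define N where "N = d - 2"
  have N: "d = N + 2" using assms by (simp add: N_def)
  \<comment> \<open>Normalizing \<open>z = 1\<close> gives \<open>\<kappa> = \<gamma> * x\<close>.
    The second equation then determines \<open>x\<close> from \<open>y\<close>, and the first
    becomes this equation for \<open>y\<close>.\<close>
  obtain y where y: "y ^ (N * (N + 1) + 1) = \<gamma> / \<alpha> * (\<gamma> / \<beta>) ^ N"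
    using nth_root_exists[of "N * (N + 1) + 1"] by auto
  then have "y \<noteq> 0" using nz by (auto simp: power_0_left)
  define x where "x = \<beta> / \<gamma> * y ^ (N + 1)"
  have "x \<noteq> 0" using \<open>y \<noteq> 0\<close> nz by (simp add: x_def)
  have "(y ^ (N + 1)) ^ N * y = y ^ (N * (N + 1) + 1)"
    by (metis power_mult mult.commute power_add power_one_right)
  then have "x ^ N * y = (\<beta> / \<gamma>) ^ N * y ^ (N * (N + 1) + 1)"
    by (simp only: x_def power_mult_distrib mult.assoc)
  also have "\<dots> = \<gamma> / \<alpha>"
    unfolding y using nz by (simp add: power_divide)
  finally have "\<alpha> * (x ^ (d - 1) * y) = \<gamma> * x"
    using nz by (simp add: N field_simps)
  moreover have "\<beta> * (y ^ (d - 1) * 1) = \<gamma> * x"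
    using nz by (simp add: x_def N)
  ultimately show ?thesis
    using \<open>x \<noteq> 0\<close> \<open>y \<noteq> 0\<close> nz
    by (intro exI[of _ x] exI[of _ y] exI[of _ 1] exI[of _ "\<gamma> * x"]) simp
qed

section \<open>Reduction to the Klein equation\<close>

lemma Const_mult_Var_power:
  "Const c * (Var i ^ k * Var j) =
    (Poly_Mapping.single (Poly_Mapping.single i k + Poly_Mapping.single j 1) c :: 'k::comm_semiring_1 poly3)"
proof -
  have "(Var i :: 'k poly3) ^ k = Poly_Mapping.single (Poly_Mapping.single i k) 1"
    by (induction k) (simp_all add: Var_def mult_single flip: single_add)
  then show ?thesis
    by (simp add: Var_def Const_def mult_single)
qed

lemma lookup_Const_mult:
  "Poly_Mapping.lookup (Const c * F) m = c * Poly_Mapping.lookup (F :: 'k::comm_semiring_1 poly3) m"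
proof -
  have "Const c * F = (\<Sum>m\<in>Poly_Mapping.keys F. Poly_Mapping.single m (c * Poly_Mapping.lookup F m))"
    by (subst (1) poly3_as_sum[of F]) (simp add: sum_distrib_left Const_def mult_single)
  then show ?thesis
    by (simp add: lookup_sum lookup_single when_def in_keys_iff)
qed

text \<open>Scaling makes the three coefficients equal, and renaming the cycle \<open>p\<close>,
  \<open>q\<close>, \<open>r\<close> to 1, 2, 3 treats both orientations at once.\<close>

lemma three_monomials_to_klein:
  fixes \<alpha> :: "3 \<Rightarrow> 'k::alg_closed_field"
  assumes d: "d \<ge> 4" and nz: "\<And>i. \<alpha> i \<noteq> 0"
    and cycle: "{p, q, r} = UNIV" "p \<noteq> q" "q \<noteq> r" "p \<noteq> r"
  shows "\<exists>B \<kappa>. invertible B \<and> \<kappa> \<noteq> 0 \<and> linear_subst B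
    (Const (\<alpha> p) * (Var p ^ (d - 1) * Var q) + Const (\<alpha> q) * (Var q ^ (d - 1) * Var r) +
     Const (\<alpha> r) * (Var r ^ (d - 1) * Var p)) = Const \<kappa> * klein_curve d"
proof -
  obtain x y z \<kappa> where s: "x \<noteq> 0" "y \<noteq> 0" "z \<noteq> 0" "\<kappa> \<noteq> 0"
    "\<alpha> p * (x ^ (d - 1) * y) = \<kappa>" "\<alpha> q * (y ^ (d - 1) * z) = \<kappa>" "\<alpha> r * (z ^ (d - 1) * x) = \<kappa>"
    using klein_scaling[OF d, of "\<alpha> p" "\<alpha> q" "\<alpha> r"] nz by metis
  define s where "s = (\<lambda>i. if i = p then x else if i = q then y else z)"
  define \<pi> :: "3 \<Rightarrow> 3" where "\<pi> = (\<lambda>i. if i = p then 1 else if i = q then 2 else 3)"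
  let ?B = "monomial_matrix s \<pi>"
  have spi: "s p = x" "s q = y" "s r = z" "\<pi> p = 1" "\<pi> q = 2" "\<pi> r = 3"
    using cycle by (auto simp: s_def \<pi>_def)
  have "\<exists>i. \<pi> i = k" for k
    using exhaust_3[of k] spi by metis
  then have "surj \<pi>" by (metis surjI)
  then have "bij \<pi>"
    using finite_UNIV_surj_inj[of \<pi>] by (simp add: bij_def)
  moreover have "s i \<noteq> 0" for i using s by (simp add: s_def)
  ultimately have "invertible ?B" by (rule invertible_monomial_matrix)
  have mono: "linear_subst ?B (Const a * (Var i ^ (d - 1) * Var k)) =
      Const (a * (s i ^ (d - 1) * s k)) * (Var (\<pi> i) ^ (d - 1) * Var (\<pi> k))" for a i k
  proof -
    have "Const (s i) ^ n = (Const (s i ^ n) :: 'k poly3)" for n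
      by (induction n) simp_all
    then show ?thesis
      by (simp add: linear_subst_mult linear_subst_power linear_subst_Var linear_subst_Const
          linear_form_monomial_matrix power_mult_distrib mult_ac)
  qed
  have add: "linear_subst ?B (f + g) = linear_subst ?B f + linear_subst ?B g" for f g
    unfolding linear_subst_def by (simp add: insertion_add)
  have "linear_subst ?B
    (Const (\<alpha> p) * (Var p ^ (d - 1) * Var q) + Const (\<alpha> q) * (Var q ^ (d - 1) * Var r) +
     Const (\<alpha> r) * (Var r ^ (d - 1) * Var p)) = Const \<kappa> * klein_curve d"
    unfolding add mono spi s klein_curve_def by (simp add: distrib_left)
  then show ?thesis using \<open>invertible ?B\<close> s by blast
qed

text \<open>The root of unity in the second conclusion is a ratio of two eigenvalues. It is recorded
  because the automorphism group of the Klein curve is built from it.\<close>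

lemma diagonal_automorphism_imp_klein:
  fixes G :: "'k::alg_closed_field poly3"
  assumes d: "d \<ge> 4" and G: "nonsingular_plane_curve d G"
    and nz: "\<And>i. t i \<noteq> 0"
    and ord: "\<And>k. (\<forall>i j. t i ^ k = t j ^ k) \<Longrightarrow> d\<^sup>2 - 3 * d + 3 dvd k"
    and inv: "linear_subst (monomial_matrix t id) G = Const c * G"
  shows "\<exists>B \<kappa>. invertible B \<and> \<kappa> \<noteq> 0 \<and> linear_subst B G = Const \<kappa> * klein_curve d"
    and "\<exists>x::'k. \<forall>k. x ^ k = 1 \<longleftrightarrow> d\<^sup>2 - 3 * d + 3 dvd k"
proof -
  let ?m = "\<lambda>i j. Poly_Mapping.single i (d - 1) + Poly_Mapping.single j 1 :: 3 \<Rightarrow>\<^sub>0 nat"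
  have "\<exists>j. ?m i j \<in> Poly_Mapping.keys G" for i
    using nonsingular_plane_curve_monomial[OF G] d by simp
  then obtain j where j: "?m i (j i) \<in> Poly_Mapping.keys G" for i by metis
  have weight: "(\<Prod>i\<in>UNIV. t i ^ Poly_Mapping.lookup m i) = c" if "m \<in> Poly_Mapping.keys G" for m
  proof -
    have "Poly_Mapping.lookup (Const c * G) m = c * Poly_Mapping.lookup G m"
      by (rule lookup_Const_mult)
    then have "(\<Prod>i\<in>UNIV. t i ^ Poly_Mapping.lookup m i) * Poly_Mapping.lookup G m =
        c * Poly_Mapping.lookup G m"
      by (simp flip: inv add: lookup_linear_subst_diagonal)
    then show ?thesis using that by (simp add: in_keys_iff)
  qed
  have weight_j: "t i ^ (d - 1) * t (j i) = c" for i
  proof -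
    \<comment> \<open>Two separate conditional factors also cover the possibility
      \<open>j i = i\<close>.\<close>
    have "(\<Prod>l\<in>UNIV. t l ^ Poly_Mapping.lookup (?m i (j i)) l) =
        (\<Prod>l\<in>UNIV. (if l = i then t i ^ (d - 1) else 1) * (if l = j i then t (j i) else 1))"
      by (intro prod.cong) (simp_all add: lookup_add lookup_single when_def power_add)
    also have "\<dots> = t i ^ (d - 1) * t (j i)"
      by (simp add: prod.distrib)
    finally show ?thesis using weight[OF j] by simp
  qed
  have "j 1 = 2 \<and> j 2 = 3 \<and> j 3 = 1 \<or> j 1 = 3 \<and> j 2 = 1 \<and> j 3 = 2"
    using equal_weights_imp_cycle[where t = t and j = j, OF d nz ord weight_j] .
  then obtain p q r where pqr: "j p = q" "j q = r" "j r = p" "{p, q, r} = UNIV" "p \<noteq> q" "q \<noteq> r" "p \<noteq> r"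
  proof (elim disjE conjE)
    assume "j 1 = 2" "j 2 = 3" "j 3 = 1"
    then show ?thesis using UNIV_3 that[of 1 2 3] by auto
  next
    assume "j 1 = 3" "j 2 = 1" "j 3 = 2"
    then show ?thesis using UNIV_3 that[of 2 1 3] by auto
  qed
  have all: "i \<in> {p, q, r}" for i using pqr by simp
  have ord': "d\<^sup>2 - 3 * d + 3 dvd k" if "t p ^ k = t q ^ k" "t q ^ k = t r ^ k" for k
  proof (rule ord)
    have "t i ^ k = t r ^ k" for i using all[of i] that by auto
    then show "\<forall>i j. t i ^ k = t j ^ k" by metis
  qed
  note kw = klein_weights[where p = "t p" and q = "t q" and r = "t r", OF d nz nz nz ord' weight_j[of p, unfolded pqr]
      weight_j[of q, unfolded pqr] weight_j[of r, unfolded pqr]]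
  show "\<exists>x::'k. \<forall>k. x ^ k = 1 \<longleftrightarrow> d\<^sup>2 - 3 * d + 3 dvd k"
    using kw(1) by blast
  have prod3: "(\<Prod>i\<in>UNIV. g i) = g p * g q * g r" for g :: "3 \<Rightarrow> 'k"
    using pqr by (simp flip: pqr(4))
  have sum3: "(\<Sum>i\<in>UNIV. g i) = g p + g q + g r" for g :: "3 \<Rightarrow> nat"
    using pqr by (simp flip: pqr(4))
  have lookup_m: "Poly_Mapping.lookup (?m a b) l = (if l = a then d - 1 else 0) + (if l = b then 1 else 0)"
    for a b l
    by (simp add: lookup_add lookup_single when_def)
  have keys: "m \<in> {?m p q, ?m q r, ?m r p}" if "m \<in> Poly_Mapping.keys G" for m
  proof -
    have "Poly_Mapping.lookup m p + Poly_Mapping.lookup m q + Poly_Mapping.lookup m r = d"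
      using that G by (simp add: nonsingular_plane_curve_def homogeneous_def sum3)
    then have exps: "(Poly_Mapping.lookup m p, Poly_Mapping.lookup m q, Poly_Mapping.lookup m r) \<in>
        {(d - 1, 1, 0), (0, d - 1, 1), (1, 0, d - 1)}"
      using kw(2) weight[OF that] by (simp add: prod3)
    have eqI: "m = m'" if "Poly_Mapping.lookup m p = Poly_Mapping.lookup m' p"
      "Poly_Mapping.lookup m q = Poly_Mapping.lookup m' q"
      "Poly_Mapping.lookup m r = Poly_Mapping.lookup m' r" for m'
      using that all by (intro poly_mapping_eqI) (metis insert_iff singletonD)
    have "m = ?m p q \<or> m = ?m q r \<or> m = ?m r p"
      using exps eqI[of "?m p q"] eqI[of "?m q r"] eqI[of "?m r p"] pqr(5-7)
      unfolding lookup_m by auto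
    then show ?thesis by simp
  qed
  define \<alpha> where "\<alpha> = (\<lambda>i. Poly_Mapping.lookup G (?m i (j i)))"
  have \<alpha>: "\<alpha> i \<noteq> 0" for i
    using j[of i] by (simp add: \<alpha>_def in_keys_iff)
  have neq: "m \<noteq> m'" if "Poly_Mapping.lookup m i \<noteq> Poly_Mapping.lookup m' i"
    for i and m m' :: "3 \<Rightarrow>\<^sub>0 nat"
    using that by auto
  have distinct: "?m p q \<noteq> ?m q r" "?m p q \<noteq> ?m r p" "?m q r \<noteq> ?m r p"
    using d pqr(5-7) neq[of "?m p q" p "?m q r"] neq[of "?m p q" p "?m r p"] neq[of "?m q r" q "?m r p"]
    unfolding lookup_m by simp_all
  have "G = (\<Sum>m\<in>{?m p q, ?m q r, ?m r p}. Poly_Mapping.single m (Poly_Mapping.lookup G m))"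
    by (subst poly3_as_sum, intro sum.mono_neutral_left) (use keys in \<open>auto simp: in_keys_iff\<close>)
  also have "\<dots> = Const (\<alpha> p) * (Var p ^ (d - 1) * Var q) + Const (\<alpha> q) * (Var q ^ (d - 1) * Var r) +
     Const (\<alpha> r) * (Var r ^ (d - 1) * Var p)"
    using distinct by (simp add: Const_mult_Var_power \<alpha>_def pqr add.assoc)
  finally have G_eq: "G = \<dots>" .
  show "\<exists>B \<kappa>. invertible B \<and> \<kappa> \<noteq> 0 \<and> linear_subst B G = Const \<kappa> * klein_curve d"
    using three_monomials_to_klein[where \<alpha> = \<alpha>, OF d \<alpha> pqr(4-7)] unfolding G_eq .
qed

text \<open>Together \<open>pow\<close> and \<open>ord\<close> say that \<open>A\<close> has order
  \<open>n\<close> modulo scalars. In eigencoordinates a power of \<open>A\<close> is scalar exactly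
  when the same powers of all eigenvalues agree, which is the form of the order used for diagonal
  matrices.\<close>

lemma automorphism_of_large_order_imp_klein:
  fixes F :: "'k::{alg_closed_field, field_char_0} poly3"
  assumes d: "d \<ge> 4" and F: "nonsingular_plane_curve d F"
    and A: "invertible A" "linear_subst A F = Const c * F"
    and pow: "\<kappa> \<noteq> 0" "\<And>v. ((*v) A ^^ (d\<^sup>2 - 3 * d + 3)) v = \<kappa> *s v"
    and ord: "\<And>k \<mu>. (\<And>v. ((*v) A ^^ k) v = \<mu> *s v) \<Longrightarrow> d\<^sup>2 - 3 * d + 3 dvd k"
  shows "\<exists>B \<mu>. invertible B \<and> \<mu> \<noteq> 0 \<and> linear_subst B F = Const \<mu> * klein_curve d"
    and "\<exists>x::'k. \<forall>k. x ^ k = 1 \<longleftrightarrow> d\<^sup>2 - 3 * d + 3 dvd k"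
proof -
  obtain P :: "'k^3^3" and t where P: "invertible P" "A ** P = P ** monomial_matrix t id"
    using diagonalizable_if_power_scalar[OF _ pow] by auto
  obtain Q where Q: "P ** Q = mat 1" "Q ** P = mat 1"
    using P(1) by (auto simp: invertible_def)
  have AP: "A *v (P *v v) = P *v (monomial_matrix t id *v v)" for v
    by (simp add: matrix_vector_mul_assoc P)
  have P_inj: "u = v" if "P *v u = P *v v" for u v
    using that Q by (metis matrix_vector_mul_assoc matrix_vector_mul_lid)
  obtain A' where A': "A' ** A = mat 1"
    using A(1) by (auto simp: invertible_def)
  have nz: "t i \<noteq> 0" for i
  proof
    assume "t i = 0"
    then have "monomial_matrix t id *v axis i 1 = (0 :: 'k^3)"
      by (simp add: vec_eq_iff axis_def)
    then have "A *v (P *v axis i 1) = A *v (P *v 0)" by (simp add: AP)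
    then have "P *v axis i 1 = P *v 0" using A' by (metis matrix_vector_mul_assoc matrix_vector_mul_lid)
    then show False using P_inj by fastforce
  qed
  have powP: "((*v) A ^^ k) (P *v v) = P *v (\<chi> i. t i ^ k * v $ i)" for k v
  proof (induction k)
    case (Suc k)
    have "monomial_matrix t id *v (\<chi> i. t i ^ k * v $ i) = (\<chi> i. t i ^ Suc k * v $ i)"
      by (simp add: vec_eq_iff mult.assoc)
    then show ?case by (simp add: Suc AP)
  qed simp
  let ?G = "linear_subst P F"
  have ord': "d\<^sup>2 - 3 * d + 3 dvd k" if "\<forall>i j. t i ^ k = t j ^ k" for k
  proof (rule ord[of k "t 1 ^ k"])
    fix v
    have "(\<chi> i. t i ^ k * (Q *v v) $ i) = t 1 ^ k *s (Q *v v)"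
      using that by (simp add: vec_eq_iff)
    then have "((*v) A ^^ k) (P *v (Q *v v)) = t 1 ^ k *s (P *v (Q *v v))"
      by (simp add: powP vec.linear_scale[OF matrix_vector_mul_linear_gen])
    then show "((*v) A ^^ k) v = t 1 ^ k *s v"
      by (simp add: matrix_vector_mul_assoc Q)
  qed
  have "linear_subst (monomial_matrix t id) ?G = linear_subst P (linear_subst A F)"
    by (simp add: linear_subst_linear_subst P)
  then have inv: "linear_subst (monomial_matrix t id) ?G = Const c * ?G"
    by (simp add: A linear_subst_mult linear_subst_Const)
  note * = diagonal_automorphism_imp_klein[OF d nonsingular_plane_curve_linear_subst[OF F P(1)] nz ord' inv]
  obtain B \<mu> where B: "invertible B" "\<mu> \<noteq> 0" "linear_subst B ?G = Const \<mu> * klein_curve d"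
    using *(1) by blast
  then have "linear_subst (P ** B) F = Const \<mu> * klein_curve d"
    by (simp add: linear_subst_linear_subst)
  then show "\<exists>B \<mu>. invertible B \<and> \<mu> \<noteq> 0 \<and> linear_subst B F = Const \<mu> * klein_curve d"
    using B P(1) invertible_mult by blast
  show "\<exists>x::'k. \<forall>k. x ^ k = 1 \<longleftrightarrow> d\<^sup>2 - 3 * d + 3 dvd k"
    by (rule *(2))
qed

section \<open>Hyperflexes of the Klein curve\<close>

text \<open>
  Here \<open>\<rho>\<close> is the ratio of the logarithmic slopes of the first two coordinates and \<open>b\<close> the ratio of the
  first two terms of the Klein equation. The hypotheses eliminate to \<open>M (M + 2) \<rho> = M\<^sup>2 - 1\<close> and then
  to \<open>M\<^sup>3 = 1\<close>.
\<close>

lemma flex_equations_unsolvable: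
  fixes \<rho> b M :: "'k::field_char_0"
  assumes M: "M = of_nat m" "m \<ge> 3" and b: "b \<noteq> 0"
    and e1: "(M + 1) * \<rho> + 1 + (M + 1) * b = (1 + b) * \<rho>"
    and e2: "M * \<rho>\<^sup>2 + 2 * \<rho> + M * b = 0"
    and e3: "(M - 1) * \<rho> ^ 3 + 3 * \<rho>\<^sup>2 + (M - 1) * b = 0"
  shows False
proof -
  \<comment> \<open>The substitution \<open>m = k + 3\<close> exhibits each divisor below as a
    positive natural number, hence as non-zero in characteristic zero.\<close>
  obtain k where k: "m = k + 3" using M(2) le_Suc_ex by (metis add.commute)
  have Mk: "M = of_nat k + 3" using M(1) by (simp add: k)
  have "M \<noteq> 0" using M by simp
  have M1: "M - 1 \<noteq> 0"
  proof -
    have "M - 1 = of_nat (k + 2)" by (simp add: Mk)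
    then show ?thesis by (simp only: of_nat_eq_0_iff)
  qed
  have M2: "M\<^sup>2 - 2 * M + 4 \<noteq> 0"
  proof -
    have "M\<^sup>2 - 2 * M + 4 = of_nat (k * k + 4 * k + 7)"
      by (simp add: Mk power2_eq_square algebra_simps)
    then show ?thesis by (simp only: of_nat_eq_0_iff)
  qed
  have M3: "M ^ 3 - 1 \<noteq> 0"
  proof -
    have "M ^ 3 - 1 = of_nat (k * k * k + 9 * k * k + 27 * k + 26)"
      by (simp add: Mk power3_eq_cube algebra_simps)
    then show ?thesis by (simp only: of_nat_eq_0_iff)
  qed
  have "\<rho> \<noteq> 0"
    using e2 \<open>M \<noteq> 0\<close> b by auto
  \<comment> \<open>This combination of \<open>e2\<close> and \<open>e3\<close> eliminates
    \<open>b\<close>; what remains is divisible by \<open>\<rho>\<close>.\<close>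
  have "\<rho> * (M * (M - 1) * \<rho>\<^sup>2 - M * (M - 4) * \<rho> - 2 * (M - 1)) =
      M * ((M - 1) * \<rho> ^ 3 + 3 * \<rho>\<^sup>2 + (M - 1) * b) - (M - 1) * (M * \<rho>\<^sup>2 + 2 * \<rho> + M * b)"
    by (simp add: power2_eq_square power3_eq_cube algebra_simps)
  then have quad: "M * (M - 1) * \<rho>\<^sup>2 - M * (M - 4) * \<rho> - 2 * (M - 1) = 0"
    using \<open>\<rho> \<noteq> 0\<close> by (simp add: e2 e3)
  \<comment> \<open>The unknown \<open>b\<close> is eliminated from \<open>e1\<close> and
    \<open>e2\<close>.\<close>
  have "M * \<rho> ^ 3 - (M\<^sup>2 + M - 2) * \<rho>\<^sup>2 + (M\<^sup>2 - 2 * M - 2) * \<rho> + M =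
      M * ((M + 1) * \<rho> + 1 + (M + 1) * b - (1 + b) * \<rho>) - (M + 1 - \<rho>) * (M * \<rho>\<^sup>2 + 2 * \<rho> + M * b)"
    by (simp add: power2_eq_square power3_eq_cube algebra_simps)
  then have cubic: "M * \<rho> ^ 3 - (M\<^sup>2 + M - 2) * \<rho>\<^sup>2 + (M\<^sup>2 - 2 * M - 2) * \<rho> + M = 0"
    by (simp add: e1 e2)
  \<comment> \<open>Pseudo-division of the cubic by the quadratic: both coefficients of the linear
    remainder share the factor \<open>M\<^sup>2 - 2 * M + 4\<close>.\<close>
  have "(M\<^sup>2 - 2 * M + 4) * (M * (M + 2) * \<rho> - (M - 1) * (M + 1)) =
      M * (M - 1) * ((M - 1) * (M * \<rho> ^ 3 - (M\<^sup>2 + M - 2) * \<rho>\<^sup>2 + (M\<^sup>2 - 2 * M - 2) * \<rho> + M) -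
        \<rho> * (M * (M - 1) * \<rho>\<^sup>2 - M * (M - 4) * \<rho> - 2 * (M - 1))) +
      (M ^ 3 - M\<^sup>2 + M + 2) * (M * (M - 1) * \<rho>\<^sup>2 - M * (M - 4) * \<rho> - 2 * (M - 1))"
    by (simp add: power2_eq_square power3_eq_cube algebra_simps)
  also have "\<dots> = 0" by (simp only: cubic quad) simp
  finally have lin: "M * (M + 2) * \<rho> = (M - 1) * (M + 1)"
    using M2 by simp
  \<comment> \<open>The multiplier \<open>M * (M + 2)\<^sup>2\<close> lets the quadratic be written
    in terms of \<open>M * (M + 2) * \<rho>\<close>, whose value is known from
    \<open>lin\<close>.\<close>
  have "(M - 1) * (M ^ 3 - 1) = - (M * (M + 2)\<^sup>2 * (M * (M - 1) * \<rho>\<^sup>2 - M * (M - 4) * \<rho> - 2 * (M - 1)))"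
  proof -
    have "M * (M + 2)\<^sup>2 * (M * (M - 1) * \<rho>\<^sup>2 - M * (M - 4) * \<rho> - 2 * (M - 1)) =
        (M - 1) * (M * (M + 2) * \<rho>)\<^sup>2 - M * (M - 4) * (M + 2) * (M * (M + 2) * \<rho>) -
        2 * (M - 1) * M * (M + 2)\<^sup>2"
      by (simp add: power2_eq_square algebra_simps)
    also have "\<dots> = (M - 1) * (1 - M ^ 3)"
      unfolding lin by (simp add: power2_eq_square power3_eq_cube algebra_simps)
    finally show ?thesis by (simp add: algebra_simps)
  qed
  also have "\<dots> = 0" unfolding quad by simp
  finally show False using M1 M3 by simp
qed

text \<open>With \<open>N = d - 1\<close>, the hypotheses \<open>e0\<close> to \<open>e3\<close> are
  the vanishing of the coefficients of 1, t, t^2, t^3 of the Klein form at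
  \<open>(x + p t, y + q t, z)\<close>. Thus no line through a point off the coordinate axes has
  contact of order 4 there.\<close>

lemma flex_coefficients_imp_zero:
  fixes x y z p q :: "'k::field_char_0"
  assumes N: "N \<ge> 4" and nz: "x \<noteq> 0" "y \<noteq> 0" "z \<noteq> 0"
    and e0: "x ^ N * y + y ^ N * z + z ^ N * x = 0"
    and e1: "of_nat N * p * x ^ (N - 1) * y + x ^ N * q + of_nat N * q * y ^ (N - 1) * z + z ^ N * p = 0"
    and e2: "of_nat (N choose 2) * p\<^sup>2 * x ^ (N - 2) * y + of_nat N * p * x ^ (N - 1) * q +
      of_nat (N choose 2) * q\<^sup>2 * y ^ (N - 2) * z = 0"
    and e3: "of_nat (N choose 3) * p ^ 3 * x ^ (N - 3) * y + of_nat (N choose 2) * p\<^sup>2 * x ^ (N - 2) * q +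
      of_nat (N choose 3) * q ^ 3 * y ^ (N - 3) * z = 0"
  shows "p = 0 \<and> q = 0"
proof -
  obtain m where m: "N = Suc m" "m \<ge> 3" using N by (cases N) auto
  define M :: 'k where "M = of_nat m"
  have M: "M \<noteq> 0" "M + 1 \<noteq> 0"
    using m(2) of_nat_neq_0[of m, where 'a = 'k] by (auto simp: M_def add.commute)
  have C1: "of_nat N = M + 1" by (simp add: M_def m)
  have choose2: "2 * (Suc i choose 2) = Suc i * i" for i
    using Suc_times_binomial_eq[of i 1] by (simp add: numeral_2_eq_2)
  have "of_nat (2 * (Suc m choose 2)) = (of_nat (Suc m * m) :: 'k)" by (simp only: choose2)
  then have C2: "2 * of_nat (N choose 2) = (M + 1) * M"
    by (simp add: M_def m algebra_simps)
  have three: "3 * (Suc m choose 3) = Suc m * (m choose 2)"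
    using Suc_times_binomial_eq[of m 2] by (simp add: numeral_3_eq_3 numeral_2_eq_2)
  have two: "2 * (m choose 2) = m * (m - 1)"
    using choose2[of "m - 1"] m(2) by simp
  have "6 * (Suc m choose 3) = 2 * (3 * (Suc m choose 3))" by simp
  also have "\<dots> = Suc m * (2 * (m choose 2))" by (simp only: three mult.left_commute)
  finally have "6 * (Suc m choose 3) = Suc m * (m * (m - 1))" by (simp only: two)
  then have "of_nat (6 * (Suc m choose 3)) = (of_nat (Suc m * (m * (m - 1))) :: 'k)" by (simp only:)
  then have C3: "6 * of_nat (N choose 3) = (M + 1) * (M * (M - 1))"
    using m(2) by (simp add: M_def m of_nat_diff algebra_simps)
  \<comment> \<open>\<open>A\<close> and \<open>B\<close> are the first two terms of the Klein form,
    \<open>\<xi>\<close> and \<open>\<eta>\<close> the logarithmic slopes of the first two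
    coordinates. By \<open>e0\<close> the third term is \<open>- (A + B)\<close>, so only the ratios
    of these quantities will matter.\<close>
  define A B \<xi> \<eta> where "A = x ^ N * y" and "B = y ^ N * z" and "\<xi> = p / x" and "\<eta> = q / y"
  have AB: "A \<noteq> 0" "B \<noteq> 0" using nz by (simp_all add: A_def B_def)
  have pq: "p = \<xi> * x" "q = \<eta> * y" using nz by (simp_all add: \<xi>_def \<eta>_def)
  have pow: "u ^ N = u ^ (N - 3) * u * u * u" "u ^ (N - 1) = u ^ (N - 3) * u * u"
    "u ^ (N - 2) = u ^ (N - 3) * u" for u :: 'k
  proof -
    have "N = N - 3 + 3" "N - 1 = N - 3 + 2" "N - 2 = N - 3 + 1" using N by simp_all
    then show "u ^ N = u ^ (N - 3) * u * u * u" "u ^ (N - 1) = u ^ (N - 3) * u * u"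
      "u ^ (N - 2) = u ^ (N - 3) * u"
      by (metis power_add power3_eq_cube power2_eq_square power_one_right mult.assoc)+
  qed
  have zp: "z ^ N * p = - (A + B) * \<xi>"
  proof -
    have "z ^ N * x + (A + B) = 0" using e0 by (simp add: A_def B_def add_ac)
    then have "z ^ N * x = - (A + B)" by (simp only: eq_neg_iff_add_eq_0)
    moreover have "z ^ N * p = z ^ N * x * \<xi>" by (simp add: pq)
    ultimately show ?thesis by (simp only:)
  qed
  have f1: "(M + 1) * A * \<xi> + A * \<eta> + (M + 1) * B * \<eta> - (A + B) * \<xi> = 0"
  proof -
    have "(M + 1) * A * \<xi> + A * \<eta> + (M + 1) * B * \<eta> - (A + B) * \<xi> =
        of_nat N * p * x ^ (N - 1) * y + x ^ N * q + of_nat N * q * y ^ (N - 1) * z + z ^ N * p"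
      unfolding zp unfolding C1 A_def B_def pq pow(1)[of x] pow(1)[of y] pow(2) by (simp add: algebra_simps)
    then show ?thesis using e1 by simp
  qed
  have f2: "M * A * \<xi>\<^sup>2 + 2 * A * \<xi> * \<eta> + M * B * \<eta>\<^sup>2 = 0"
  proof -
    have "(M + 1) * (M * A * \<xi>\<^sup>2 + 2 * A * \<xi> * \<eta> + M * B * \<eta>\<^sup>2) =
      2 * of_nat (N choose 2) * A * \<xi>\<^sup>2 + 2 * (M + 1) * A * \<xi> * \<eta> + 2 * of_nat (N choose 2) * B * \<eta>\<^sup>2"
      unfolding C2 by (simp add: algebra_simps)
    also have "\<dots> = 2 * (of_nat (N choose 2) * p\<^sup>2 * x ^ (N - 2) * y + of_nat N * p * x ^ (N - 1) * q +
      of_nat (N choose 2) * q\<^sup>2 * y ^ (N - 2) * z)"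
      unfolding C1 A_def B_def pq pow(1)[of x] pow(1)[of y] pow(2,3)
      by (simp add: power2_eq_square algebra_simps)
    also have "\<dots> = 0" unfolding e2 by simp
    finally show ?thesis using M by simp
  qed
  have f3: "(M - 1) * A * \<xi> ^ 3 + 3 * A * \<xi>\<^sup>2 * \<eta> + (M - 1) * B * \<eta> ^ 3 = 0"
  proof -
    have "(M + 1) * M * ((M - 1) * A * \<xi> ^ 3 + 3 * A * \<xi>\<^sup>2 * \<eta> + (M - 1) * B * \<eta> ^ 3) =
      (6 * of_nat (N choose 3)) * A * \<xi> ^ 3 + 3 * (2 * of_nat (N choose 2)) * A * \<xi>\<^sup>2 * \<eta> +
      (6 * of_nat (N choose 3)) * B * \<eta> ^ 3"
      unfolding C2 C3 by (simp add: algebra_simps)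
    also have "\<dots> = 6 * (of_nat (N choose 3) * p ^ 3 * x ^ (N - 3) * y +
      of_nat (N choose 2) * p\<^sup>2 * x ^ (N - 2) * q + of_nat (N choose 3) * q ^ 3 * y ^ (N - 3) * z)"
      unfolding A_def B_def pq pow(1)[of x] pow(1)[of y] pow(3)
      by (simp add: power2_eq_square power3_eq_cube algebra_simps)
    also have "\<dots> = 0" unfolding e3 by simp
    finally show ?thesis using M by simp
  qed
  have "\<eta> = 0"
  proof (rule ccontr)
    assume \<eta>: "\<eta> \<noteq> 0"
    define \<rho> b where "\<rho> = \<xi> / \<eta>" and "b = B / A"
    have \<xi>: "\<xi> = \<rho> * \<eta>" "B = b * A" using \<eta> AB by (simp_all add: \<rho>_def b_def)
    have "(M + 1) * \<rho> + 1 + (M + 1) * b - (1 + b) * \<rho> = 0"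
    proof -
      have "A * \<eta> * ((M + 1) * \<rho> + 1 + (M + 1) * b - (1 + b) * \<rho>) = 0"
        using f1 by (simp add: \<xi> algebra_simps)
      then show ?thesis using \<eta> AB by simp
    qed
    moreover have "M * \<rho>\<^sup>2 + 2 * \<rho> + M * b = 0"
    proof -
      have "A * \<eta>\<^sup>2 * (M * \<rho>\<^sup>2 + 2 * \<rho> + M * b) = 0"
        using f2 by (simp add: \<xi> power2_eq_square algebra_simps)
      then show ?thesis using \<eta> AB by simp
    qed
    moreover have "(M - 1) * \<rho> ^ 3 + 3 * \<rho>\<^sup>2 + (M - 1) * b = 0"
    proof -
      have "A * \<eta> ^ 3 * ((M - 1) * \<rho> ^ 3 + 3 * \<rho>\<^sup>2 + (M - 1) * b) = 0"
        using f3 by (simp add: \<xi> power2_eq_square power3_eq_cube algebra_simps)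
      then show ?thesis using \<eta> AB by simp
    qed
    moreover have "b \<noteq> 0" using AB by (simp add: b_def)
    ultimately show False
      using flex_equations_unsolvable[of M m b \<rho>] m(2) by (simp add: M_def)
  qed
  moreover from this have "\<xi> = 0"
    using f2 M AB by simp
  ultimately show ?thesis by (simp add: pq)
qed

section \<open>The Klein form on lines, with indices modulo 3\<close>

lemma poly3_eval_Var: "poly3_eval (Var i) v = v $ i"
  by (simp add: poly3_eval_def insertion_Var)

lemma poly3_eval_klein_curve:
  "poly3_eval (klein_curve d) v = v $ 1 ^ (d - 1) * v $ 2 + v $ 2 ^ (d - 1) * v $ 3 + v $ 3 ^ (d - 1) * v $ 1"
proof -
  have add: "poly3_eval (f + g) v = poly3_eval f v + poly3_eval g v"
    and mult: "poly3_eval (f * g) v = poly3_eval f v * poly3_eval g v" for f g :: "'a poly3"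
    by (simp_all add: poly3_eval_def insertion_add insertion_mult)
  have "poly3_eval (Const 1 :: 'a poly3) v = 1"
    unfolding poly3_eval_def Const_def by (subst insertion_single) simp_all
  then have "poly3_eval (Var i ^ n) v = v $ i ^ n" for i n
    by (induction n) (simp_all add: mult poly3_eval_Var)
  then show ?thesis
    by (simp add: klein_curve_def add mult poly3_eval_Var)
qed

text \<open>Addition in the index type is modulo 3, so \<open>i + 1\<close> and \<open>i + 2\<close>
  are the cyclic neighbours of \<open>i\<close>. The rotational symmetry of the Klein form then lets
  one computation serve all three indices.\<close>

lemma vec3_cyclic_cases:
  obtains "i = (1::3)" "i + 1 = 2" "i + 2 = 3" | "i = 2" "i + 1 = 3" "i + 2 = 1"
    | "i = 3" "i + 1 = 1" "i + 2 = 2"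
  using exhaust_3[of i] by fastforce

lemma klein_curve_cyclic:
  "poly3_eval (klein_curve d) v = v $ i ^ (d - 1) * v $ (i + 1) +
    v $ (i + 1) ^ (d - 1) * v $ (i + 2) + v $ (i + 2) ^ (d - 1) * v $ i"
proof (cases i rule: vec3_cyclic_cases)
  case 1
  then show ?thesis unfolding 1(2,3) by (simp add: poly3_eval_klein_curve)
next
  case 2
  then show ?thesis unfolding 2(2,3) by (simp add: poly3_eval_klein_curve)
next
  case 3
  then show ?thesis unfolding 3(2,3) by (simp add: poly3_eval_klein_curve)
qed

text \<open>By \<open>K\<close> the form vanishes at \<open>u\<close> to order at least
  \<open>d - 1 \<ge> 4\<close> along the line through \<open>u\<close> and \<open>w\<close>. This is
  where \<open>d \<ge> 5\<close> is used.\<close>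

lemma klein_hyperflex_has_zero_coordinate:
  fixes u w :: "'k::field_char_0^3"
  assumes d: "d \<ge> 5" and indep: "\<And>\<zeta>. w \<noteq> \<zeta> *s u"
    and K: "\<And>s t. poly3_eval (klein_curve d) (s *s u + t *s w) = c * s * t ^ (d - 1)"
  shows "\<exists>i. u $ i = 0"
proof (rule ccontr)
  assume "\<not> ?thesis"
  then have nz: "u $ 1 \<noteq> 0" "u $ 2 \<noteq> 0" "u $ 3 \<noteq> 0" by auto
  define N where "N = d - 1"
  have N: "N \<ge> 4" using d by (simp add: N_def)
  \<comment> \<open>Changing the direction by a multiple of \<open>u\<close> keeps the line and
    makes the third coordinate constant along it.\<close>
  define \<zeta> where "\<zeta> = w $ 3 / u $ 3"
  define w' where "w' = w - \<zeta> *s u"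
  have w'3: "w' $ 3 = 0" using nz by (simp add: w'_def \<zeta>_def)
  let ?x = "u $ 1" and ?y = "u $ 2" and ?z = "u $ 3" and ?p = "w' $ 1" and ?q = "w' $ 2"
  let ?P = "[:?y, ?q:] * [:?x, ?p:] ^ N + [:?z:] * [:?y, ?q:] ^ N + [:?z ^ N:] * [:?x, ?p:]"
  let ?Q = "[:c, - (c * \<zeta>):] * Polynomial.monom 1 N"
  have "poly ?P t = poly ?Q t" for t
  proof -
    \<comment> \<open>The new parametrization only rescales the coefficient of \<open>u\<close>, so
      the factor \<open>t ^ N\<close> survives.\<close>
    have "(1 - t * \<zeta>) *s u + t *s w = u + t *s w'"
      by (simp add: w'_def vec_eq_iff algebra_simps)
    then have "poly3_eval (klein_curve d) (u + t *s w') = c * (1 - t * \<zeta>) * t ^ N"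
      using K[of "1 - t * \<zeta>" t] by (simp add: N_def)
    then show ?thesis
      by (simp add: poly3_eval_klein_curve w'3 poly_monom N_def algebra_simps)
  qed
  then have PQ: "?P = ?Q" using poly_eq_poly_eq_iff by blast
  have "Polynomial.coeff ?Q k = 0" if "k < N" for k
    using that by (simp add: coeff_pCons split: nat.split)
  then have coeffs: "Polynomial.coeff ?P k = 0" if "k < N" for k
    using that unfolding PQ by blast
  have "?p = 0 \<and> ?q = 0"
  proof (rule flex_coefficients_imp_zero[OF N nz])
    show "?x ^ N * ?y + ?y ^ N * ?z + ?z ^ N * ?x = 0"
      using coeffs[of 0] N by (simp add: coeff_linear_poly_power mult_ac)
    show "of_nat N * ?p * ?x ^ (N - 1) * ?y + ?x ^ N * ?q + of_nat N * ?q * ?y ^ (N - 1) * ?z + ?z ^ N * ?p = 0"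
      using coeffs[of 1] N by (simp add: coeff_linear_poly_power coeff_pCons mult_ac)
    show "of_nat (N choose 2) * ?p\<^sup>2 * ?x ^ (N - 2) * ?y + of_nat N * ?p * ?x ^ (N - 1) * ?q +
        of_nat (N choose 2) * ?q\<^sup>2 * ?y ^ (N - 2) * ?z = 0"
      using coeffs[of "Suc 1"] N
      by (simp add: coeff_linear_poly_power coeff_pCons mult_ac numeral_2_eq_2)
    show "of_nat (N choose 3) * ?p ^ 3 * ?x ^ (N - 3) * ?y + of_nat (N choose 2) * ?p\<^sup>2 * ?x ^ (N - 2) * ?q +
        of_nat (N choose 3) * ?q ^ 3 * ?y ^ (N - 3) * ?z = 0"
      using coeffs[of "Suc 2"] N
      by (simp add: coeff_linear_poly_power coeff_pCons mult_ac numeral_3_eq_3 numeral_2_eq_2)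
  qed
  then have "w' = 0" using w'3 by (simp add: vec_eq_iff forall_3)
  then show False using indep[of \<zeta>] by (simp add: w'_def)
qed

text \<open>
  The tangent line at a coordinate point \<open>e\<^sub>k\<close> meets the Klein curve there with multiplicity \<open>d - 1\<close>,
  and for \<open>d \<ge> 5\<close> only the coordinate points have such tangents. Hence a projectivity preserving the
  curve permutes the coordinate points.
\<close>

lemma klein_automorphism_column:
  fixes A :: "'k::field_char_0^3^3"
  assumes d: "d \<ge> 5" and A: "invertible A"
    and K: "\<And>v. poly3_eval (klein_curve d) (A *v v) = c * poly3_eval (klein_curve d) v"
  shows "\<exists>k a. a \<noteq> 0 \<and> A *v axis i 1 = axis k a"
proof -
  \<comment> \<open>The tangent at the \<open>i\<close>-th coordinate point is spanned by that point
    and the one with index \<open>i + 2\<close>; on it only the term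
    \<open>X\<^sub>i\<^sub>+\<^sub>2\<^sup>d\<^sup>-\<^sup>1 X\<^sub>i\<close> survives.\<close>
  define u w where "u = A *v axis i 1" and "w = A *v axis (i + 2) 1"
  have inj: "v = v'" if "A *v v = A *v v'" for v v'
    using that A unfolding invertible_def by (metis matrix_vector_mul_assoc matrix_vector_mul_lid)
  have i2: "i + 2 \<noteq> i" "i + 1 \<noteq> i" "i + 2 \<noteq> i + 1" by (cases i rule: vec3_cyclic_cases; simp)+
  have "poly3_eval (klein_curve d) (s *s u + t *s w) = c * s * t ^ (d - 1)" for s t
  proof -
    have "s *s u + t *s w = A *v (s *s axis i 1 + t *s axis (i + 2) 1)"
      by (simp add: u_def w_def vec.linear_add[OF matrix_vector_mul_linear_gen]
          vec.linear_scale[OF matrix_vector_mul_linear_gen])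
    moreover have "poly3_eval (klein_curve d) (s *s axis i 1 + t *s axis (i + 2) 1) = s * t ^ (d - 1)"
      using d i2 by (simp add: klein_curve_cyclic[of d _ i] axis_def)
    ultimately show ?thesis by (simp add: K del: One_nat_def)
  qed
  moreover have "w \<noteq> \<zeta> *s u" for \<zeta>
  proof
    assume "w = \<zeta> *s u"
    then have "A *v axis (i + 2) 1 = A *v (\<zeta> *s axis i 1)"
      by (simp add: u_def w_def vec.linear_scale[OF matrix_vector_mul_linear_gen])
    then have "axis (i + 2) 1 = \<zeta> *s (axis i 1 :: 'k^3)" by (rule inj)
    then have "axis (i + 2) 1 $ (i + 2) = (\<zeta> *s (axis i 1 :: 'k^3)) $ (i + 2)" by simp
    then show False using i2 by (simp add: axis_def)
  qed
  ultimately obtain l where l: "u $ l = 0"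
    using klein_hyperflex_has_zero_coordinate[OF d] by blast
  have "u \<noteq> 0"
  proof
    assume "u = 0"
    then have "A *v axis i 1 = A *v 0" by (simp add: u_def)
    then show False using inj by fastforce
  qed
  \<comment> \<open>Where one coordinate vanishes the Klein form is a single monomial in the other
    two, so a point of the curve there has a second zero coordinate.\<close>
  have "poly3_eval (klein_curve d) (axis i 1 :: 'k^3) = 0"
    using d i2 by (simp add: klein_curve_cyclic[of d _ i] axis_def)
  then have "poly3_eval (klein_curve d) u = 0"
    by (simp add: u_def K)
  then have "u $ (l + 1) = 0 \<or> u $ (l + 2) = 0"
    using l d by (simp add: klein_curve_cyclic[of d _ l] power_0_left)
  moreover have "m = l \<or> m = l + 1 \<or> m = l + 2" for m
    using exhaust_3[of m] by (cases l rule: vec3_cyclic_cases) auto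
  ultimately obtain k where "\<And>m. m \<noteq> k \<Longrightarrow> u $ m = 0"
    using l by metis
  then have "u = axis k (u $ k)" by (simp add: vec_eq_iff axis_def)
  moreover from this have "u $ k \<noteq> 0" using \<open>u \<noteq> 0\<close> by (metis axis_eq_0_iff)
  ultimately show ?thesis unfolding u_def by blast
qed

text \<open>On the line joining two cyclically consecutive coordinate points the form has degree 1
  in the coordinate of the second point and degree \<open>d - 1\<close> in that of the first. This
  asymmetry fixes the orientation, so the coordinate points are rotated.\<close>

lemma klein_automorphism_monomial:
  fixes A :: "'k::field_char_0^3^3"
  assumes d: "d \<ge> 5" and A: "invertible A" and c: "c \<noteq> 0"
    and K: "\<And>v. poly3_eval (klein_curve d) (A *v v) = c * poly3_eval (klein_curve d) v"
  shows "\<exists>r a. A = monomial_matrix (\<lambda>l. a (l - r)) (\<lambda>l. l - r) \<and> (\<forall>i. a i \<noteq> 0) \<and>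
    (\<forall>i. a i ^ (d - 1) * a (i + 1) = c)"
proof -
  obtain \<rho> a where a: "\<And>i. a i \<noteq> 0" "\<And>i. A *v axis i 1 = axis (\<rho> i) (a i)"
    using klein_automorphism_column[OF d A K] by metis
  have three: "i + 1 + 1 = i + 2" "i + 1 + 2 = i" "i + 1 \<noteq> i" "i + 2 \<noteq> i" "i + 2 \<noteq> i + 1" for i :: 3
    by (cases i rule: vec3_cyclic_cases; simp)+
  have step: "\<rho> (i + 1) = \<rho> i + 1 \<and> a i ^ (d - 1) * a (i + 1) = c" for i
  proof -
    have K': "poly3_eval (klein_curve d) (axis (\<rho> i) (a i) + axis (\<rho> (i + 1)) (t * a (i + 1))) = c * t" for t
    proof -
      have "axis (\<rho> i) (a i) + axis (\<rho> (i + 1)) (t * a (i + 1)) = A *v (axis i 1 + t *s axis (i + 1) 1)"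
        by (simp add: a vec.linear_add[OF matrix_vector_mul_linear_gen]
            vec.linear_scale[OF matrix_vector_mul_linear_gen]) (simp add: axis_def vec_eq_iff)
      moreover have "poly3_eval (klein_curve d) (axis i 1 + t *s axis (i + 1) 1) = t"
        using d three by (simp add: klein_curve_cyclic[of d _ i] axis_def)
      ultimately show ?thesis by (simp add: K)
    qed
    have "\<rho> (i + 1) \<in> {\<rho> i, \<rho> i + 1, \<rho> i + 2}"
      using exhaust_3[of "\<rho> (i + 1)"] by (cases "\<rho> i" rule: vec3_cyclic_cases) auto
    then consider "\<rho> (i + 1) = \<rho> i" | "\<rho> (i + 1) = \<rho> i + 1" | "\<rho> (i + 1) = \<rho> i + 2" by blast
    then show ?thesis
    proof cases
      case 1
      then have "c = 0"
        using K'[of 1] d three by (simp add: klein_curve_cyclic[of d _ "\<rho> i"] axis_def power_0_left)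
      then show ?thesis using c by simp
    next
      case 2
      then show ?thesis
        using K'[of 1] d three by (simp add: klein_curve_cyclic[of d _ "\<rho> i"] axis_def power_0_left)
    next
      case 3
      then have t: "(t * a (i + 1)) ^ (d - 1) * a i = c * t" for t
        using K'[of t] d three by (simp add: klein_curve_cyclic[of d _ "\<rho> i"] axis_def power_0_left)
      \<comment> \<open>For the reversed orientation a power \<open>t ^ (d - 1)\<close> would be
        proportional to \<open>t\<close>; the values at \<open>t = 1\<close> and
        \<open>t = 2\<close> contradict this in characteristic zero.\<close>
      have "2 ^ (d - 1) * c = 2 * c"
        using t[of 2] unfolding t[of 1, simplified, symmetric] by (simp add: power_mult_distrib mult_ac)
      then have "(2 :: 'k) ^ (d - 1) = 2 ^ 1" using c by simp
      then have "(of_nat (2 ^ (d - 1)) :: 'k) = of_nat (2 ^ 1)" by (simp only: of_nat_power of_nat_numeral)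
      then have "(2::nat) ^ (d - 1) = 2 ^ 1" by (simp only: of_nat_eq_iff)
      then have "d - 1 = 1" by (subst (asm) power_inject_exp) auto
      then show ?thesis using d by simp
    qed
  qed
  \<comment> \<open>The index 3 is the zero of the index type, so its image is the amount of
    rotation.\<close>
  define r where "r = \<rho> 3"
  have "\<rho> 1 = 1 + r" "\<rho> 2 = 2 + r" "\<rho> 3 = 3 + r"
  proof -
    have four: "(4::3) = 1" by simp
    show "\<rho> 1 = 1 + r" "\<rho> 2 = 2 + r" "\<rho> 3 = 3 + r"
      using step[of 3] step[of 1] by (simp_all add: r_def add_ac four)
  qed
  then have \<rho>: "\<rho> i = i + r" for i
    using exhaust_3[of i] by auto
  have "A $ l $ i = monomial_matrix (\<lambda>l. a (l - r)) (\<lambda>l. l - r) $ l $ i" for l i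
  proof -
    have "A $ l $ i = (A *v axis i 1) $ l"
      by (simp add: matrix_vector_mult_def axis_def if_distrib[of "\<lambda>x. _ * x"] cong: if_cong)
    also have "\<dots> = monomial_matrix (\<lambda>l. a (l - r)) (\<lambda>l. l - r) $ l $ i"
      unfolding a \<rho> by (auto simp: axis_def monomial_matrix_def)
    finally show ?thesis .
  qed
  then have "A = monomial_matrix (\<lambda>l. a (l - r)) (\<lambda>l. l - r)"
    by (simp add: vec_eq_iff)
  then show ?thesis using a step by blast
qed

section \<open>Normal forms in the presented group\<close>

definition letter_val :: "('a, 'b) monoid_scheme \<Rightarrow> ('g \<Rightarrow> 'a) \<Rightarrow> 'g \<times> bool \<Rightarrow> 'a" where
  "letter_val G f = (\<lambda>(g, b). if b then f g else inv\<^bsub>G\<^esub> f g)"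

definition word_val :: "('a, 'b) monoid_scheme \<Rightarrow> ('g \<Rightarrow> 'a) \<Rightarrow> 'g word \<Rightarrow> 'a" where
  "word_val G f w = foldr (\<lambda>x y. letter_val G f x \<otimes>\<^bsub>G\<^esub> y) w \<one>\<^bsub>G\<^esub>"

context group
begin

context
  fixes f :: "'g \<Rightarrow> 'a"
  assumes f: "f g \<in> carrier G"
begin

lemma letter_val_closed [simp]: "letter_val G f x \<in> carrier G"
  using f by (auto simp: letter_val_def split: prod.split)

lemma word_val_closed [simp]: "word_val G f w \<in> carrier G"
  by (induction w) (simp_all add: word_val_def)

lemma word_val_append: "word_val G f (u @ v) = word_val G f u \<otimes> word_val G f v"
proof (induction u)
  case Nil
  then show ?case using word_val_closed[of v] by (simp add: word_val_def)
next
  case (Cons x u)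
  then show ?case
    using word_val_closed[of u] word_val_closed[of v] by (simp add: word_val_def m_assoc)
qed

lemma word_val_replicate: "word_val G f (replicate n x) = letter_val G f x [^] n"
proof (induction n)
  case (Suc n)
  have "word_val G f (replicate (Suc n) x) = letter_val G f x \<otimes> word_val G f (replicate n x)"
    by (simp add: word_val_def)
  then show ?case by (simp only: Suc nat_pow_Suc2[OF letter_val_closed])
qed (simp add: word_val_def)

lemma word_val_cong:
  assumes "word_cong R u v" "\<And>l r. (l, r) \<in> R \<Longrightarrow> word_val G f l = word_val G f r"
  shows "word_val G f u = word_val G f v"
  using assms(1)
proof induction
  case (cancel u g b v)
  have "word_val G f [(g, b), (g, \<not> b)] = \<one>"
    using f[of g] by (simp add: word_val_def letter_val_def)
  then show ?case by (simp add: word_val_append del: append.simps append_Cons)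
next
  case (rel l r u v)
  then show ?case using assms(2) by (simp add: word_val_append)
qed auto

end

lemma pow_mod_exponent:
  assumes "x \<in> carrier G" "x [^] (m::nat) = \<one>"
  shows "x [^] (k::nat) = x [^] (k mod m)"
proof -
  have "x [^] k = x [^] (m * (k div m) + k mod m)" by simp
  also have "\<dots> = (x [^] m) [^] (k div m) \<otimes> x [^] (k mod m)"
    using assms(1) by (simp only: nat_pow_mult nat_pow_pow nat_pow_closed)
  finally show ?thesis using assms by simp
qed

text \<open>Moving powers of \<open>t\<close> to the right past \<open>s\<close> is the rewriting
  step that brings words to normal form.\<close>

lemma pow_conjugation:
  assumes s: "s \<in> carrier G" "t \<in> carrier G" and "t \<otimes> s = s \<otimes> t [^] (k::nat)"
  shows "t [^] (j::nat) \<otimes> s = s \<otimes> t [^] (k * j)"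
proof (induction j)
  case (Suc j)
  have "t [^] Suc j \<otimes> s = t [^] j \<otimes> (t \<otimes> s)" using s by (simp add: m_assoc)
  also have "\<dots> = (t [^] j \<otimes> s) \<otimes> t [^] k" using s by (simp add: assms(3) m_assoc)
  also have "\<dots> = s \<otimes> t [^] (k * Suc j)"
    using s by (simp add: Suc m_assoc nat_pow_mult add.commute)
  finally show ?case .
qed (use s in simp)

end

text \<open>
  Every word reduces to a normal form \<open>\<sigma>\<^sup>i \<tau>\<^sup>j\<close>, so a group satisfying the relations in which these
  normal forms are exhaustive and distinct is the presented group.
\<close>

lemma klein_presented_group_normal_form:
  assumes n: "n = d\<^sup>2 - 3 * d + 3" "n > 0"
  shows "\<exists>i<3. \<exists>j<n. word_class (klein_relations d) w =
    word_class (klein_relations d) (replicate i (Sigma, True) @ replicate j (Tau, True))"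
proof -
  let ?R = "klein_relations d"
  let ?P = "presented_group ?R"
  interpret P: group ?P by (rule group_presented_group)
  define s t where "s = word_class ?R [(Sigma, True)]" and "t = word_class ?R [(Tau, True)]"
  have closed: "word_class ?R u \<in> carrier ?P" for u by (simp add: presented_group_def)
  have st: "s \<in> carrier ?P" "t \<in> carrier ?P" by (simp_all add: s_def t_def closed)
  have one: "word_class ?R [] = \<one>\<^bsub>?P\<^esub>" by (simp add: presented_group_def)
  have pow: "word_class ?R (replicate m x) = word_class ?R [x] [^]\<^bsub>?P\<^esub> m" for m x
  proof (induction m)
    case (Suc m)
    have "word_class ?R (replicate (Suc m) x) = word_class ?R [x] \<otimes>\<^bsub>?P\<^esub> word_class ?R (replicate m x)"
      by (simp add: presented_group_mult)
    then show ?case by (simp only: Suc P.nat_pow_Suc2[OF closed])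
  qed (simp add: one)
  have rel: "word_class ?R l = word_class ?R r" if "(l, r) \<in> ?R" for l r
    using word_cong.rel[OF that, of "[]" "[]"] by (simp add: word_class_eq_iff)
  have inverse: "word_class ?R [(g, False)] = inv\<^bsub>?P\<^esub> word_class ?R [(g, True)]" for g
  proof (rule P.inv_equality[symmetric])
    have "word_cong ?R [(g, False), (g, True)] []"
      using word_cong.cancel[of ?R "[]" g False "[]"] by simp
    then show "word_class ?R [(g, False)] \<otimes>\<^bsub>?P\<^esub> word_class ?R [(g, True)] = \<one>\<^bsub>?P\<^esub>"
      by (simp add: presented_group_mult word_class_eq_iff flip: one)
  qed (simp_all add: closed)
  have "(replicate n (Tau, True), []) \<in> ?R" "(replicate 3 (Sigma, True), []) \<in> ?R"
    by (simp_all add: klein_relations_def n)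
  from this[THEN rel] have tn: "t [^]\<^bsub>?P\<^esub> n = \<one>\<^bsub>?P\<^esub>" and s3: "s [^]\<^bsub>?P\<^esub> (3::nat) = \<one>\<^bsub>?P\<^esub>"
    by (simp_all only: s_def t_def one pow)
  \<comment> \<open>Inverse letters become positive powers, so natural exponents suffice from here
    on.\<close>
  have inv_t: "inv\<^bsub>?P\<^esub> t = t [^]\<^bsub>?P\<^esub> (n - 1)"
  proof (rule P.inv_equality)
    show "t [^]\<^bsub>?P\<^esub> (n - 1) \<otimes>\<^bsub>?P\<^esub> t = \<one>\<^bsub>?P\<^esub>"
      using tn n(2) by (metis P.nat_pow_Suc Suc_diff_1)
  qed (use st in simp_all)
  have inv_s: "inv\<^bsub>?P\<^esub> s = s \<otimes>\<^bsub>?P\<^esub> s"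
    using s3 st by (intro P.inv_equality) (simp_all add: numeral_3_eq_3)
  have "word_class ?R [(Tau, True), (Sigma, True)] =
      word_class ?R ([(Sigma, True)] @ replicate (d - 1) (Tau, False))"
    by (rule rel) (simp add: klein_relations_def)
  then have "t \<otimes>\<^bsub>?P\<^esub> s = s \<otimes>\<^bsub>?P\<^esub> (inv\<^bsub>?P\<^esub> t) [^]\<^bsub>?P\<^esub> (d - 1)"
    by (simp add: s_def t_def presented_group_mult flip: inverse pow)
  then have ts: "t \<otimes>\<^bsub>?P\<^esub> s = s \<otimes>\<^bsub>?P\<^esub> t [^]\<^bsub>?P\<^esub> ((n - 1) * (d - 1))"
    using st by (simp add: inv_t P.nat_pow_pow)
  \<comment> \<open>Words are built by appending letters, so it is enough that \<open>M\<close> is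
    closed under right multiplication by the generators and their inverses. Exponents are reduced
    only at the end.\<close>
  define M where "M = {s [^]\<^bsub>?P\<^esub> i \<otimes>\<^bsub>?P\<^esub> t [^]\<^bsub>?P\<^esub> j | (i :: nat) (j :: nat). True}"
  have M_carrier: "x \<in> carrier ?P" if "x \<in> M" for x
    using that by (auto simp: M_def intro!: P.m_closed P.nat_pow_closed st)
  have M_t: "x \<otimes>\<^bsub>?P\<^esub> t [^]\<^bsub>?P\<^esub> k \<in> M" if x: "x \<in> M" for x and k :: nat
  proof -
    obtain i j :: nat where "x = s [^]\<^bsub>?P\<^esub> i \<otimes>\<^bsub>?P\<^esub> t [^]\<^bsub>?P\<^esub> j"
      using x by (auto simp: M_def)
    then have "x \<otimes>\<^bsub>?P\<^esub> t [^]\<^bsub>?P\<^esub> k = s [^]\<^bsub>?P\<^esub> i \<otimes>\<^bsub>?P\<^esub> t [^]\<^bsub>?P\<^esub> (j + k)"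
      using st by (simp add: P.m_assoc P.nat_pow_mult)
    then show ?thesis unfolding M_def by blast
  qed
  have M_s: "x \<otimes>\<^bsub>?P\<^esub> s \<in> M" if x: "x \<in> M" for x
  proof -
    obtain i j :: nat where "x = s [^]\<^bsub>?P\<^esub> i \<otimes>\<^bsub>?P\<^esub> t [^]\<^bsub>?P\<^esub> j"
      using x by (auto simp: M_def)
    then have "x \<otimes>\<^bsub>?P\<^esub> s = s [^]\<^bsub>?P\<^esub> i \<otimes>\<^bsub>?P\<^esub> (t [^]\<^bsub>?P\<^esub> j \<otimes>\<^bsub>?P\<^esub> s)"
      using st by (simp add: P.m_assoc)
    also have "\<dots> = s [^]\<^bsub>?P\<^esub> Suc i \<otimes>\<^bsub>?P\<^esub> t [^]\<^bsub>?P\<^esub> ((n - 1) * (d - 1) * j)"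
      using st by (simp add: P.pow_conjugation[OF st ts] P.m_assoc)
    finally show ?thesis unfolding M_def by blast
  qed
  have "word_class ?R w \<in> M"
  proof (induction w rule: rev_induct)
    case Nil
    have "\<one>\<^bsub>?P\<^esub> = s [^]\<^bsub>?P\<^esub> (0::nat) \<otimes>\<^bsub>?P\<^esub> t [^]\<^bsub>?P\<^esub> (0::nat)" by simp
    then show ?case unfolding one M_def by blast
  next
    case (snoc x w)
    obtain g b where x: "x = (g, b)" by force
    have eq: "word_class ?R (w @ [x]) = word_class ?R w \<otimes>\<^bsub>?P\<^esub> word_class ?R [x]"
      by (simp add: presented_group_mult)
    consider "x = (Tau, True)" | "x = (Tau, False)" | "x = (Sigma, True)" | "x = (Sigma, False)"
      using x by (cases g; cases b) auto
    then show ?case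
    proof cases
      case 1
      then show ?thesis using M_t[OF snoc, of 1] st eq by (simp add: t_def)
    next
      case 2
      then show ?thesis using M_t[OF snoc, of "n - 1"] eq by (simp add: inverse inv_t flip: t_def)
    next
      case 3
      then show ?thesis using M_s[OF snoc] eq by (simp flip: s_def)
    next
      case 4
      have "word_class ?R w \<otimes>\<^bsub>?P\<^esub> (s \<otimes>\<^bsub>?P\<^esub> s) \<in> M"
        using M_s[OF M_s[OF snoc]] st closed by (simp add: P.m_assoc)
      then show ?thesis using 4 eq by (simp add: inverse inv_s flip: s_def)
    qed
  qed
  then obtain i j :: nat where "word_class ?R w = s [^]\<^bsub>?P\<^esub> i \<otimes>\<^bsub>?P\<^esub> t [^]\<^bsub>?P\<^esub> j"
    by (auto simp: M_def)
  also have "s [^]\<^bsub>?P\<^esub> i = s [^]\<^bsub>?P\<^esub> (i mod 3)"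
    by (rule P.pow_mod_exponent[OF st(1) s3])
  also have "t [^]\<^bsub>?P\<^esub> j = t [^]\<^bsub>?P\<^esub> (j mod n)"
    by (rule P.pow_mod_exponent[OF st(2) tn])
  finally have "word_class ?R w = word_class ?R
      (replicate (i mod 3) (Sigma, True) @ replicate (j mod n) (Tau, True))"
    by (simp add: s_def t_def flip: pow presented_group_mult)
  then show ?thesis using n(2) by (meson mod_less_divisor zero_less_numeral)
qed

text \<open>Evaluation of words is well defined by \<open>rels\<close> and surjective by
  \<open>generate\<close>. Its kernel is trivial because every class has a normal form, so
  \<open>distinct\<close> only has to speak about the identity.\<close>

lemma iso_klein_presented_group:
  fixes G (structure)
  assumes "group G" and n: "n = d\<^sup>2 - 3 * d + 3" "n > 0"
    and s: "s \<in> carrier G" and t: "t \<in> carrier G"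
    and rels: "t [^] n = \<one>" "s [^] (3::nat) = \<one>" "t \<otimes> s = s \<otimes> (inv t) [^] (d - 1)"
    and generate: "\<And>g. g \<in> carrier G \<Longrightarrow> \<exists>i j. g = s [^] (i::nat) \<otimes> t [^] (j::nat)"
    and distinct: "\<And>i j. i < 3 \<Longrightarrow> j < n \<Longrightarrow> s [^] (i::nat) \<otimes> t [^] (j::nat) = \<one> \<Longrightarrow> i = 0 \<and> j = 0"
  shows "G \<cong> presented_group (klein_relations d)"
proof -
  interpret group G by fact
  let ?R = "klein_relations d"
  let ?P = "presented_group ?R"
  interpret P: group ?P by (rule group_presented_group)
  define f where "f = (\<lambda>g. case g of Tau \<Rightarrow> t | Sigma \<Rightarrow> s)"
  have f: "f g \<in> carrier G" for g using s t by (cases g) (simp_all add: f_def)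
  let ?v = "word_val G f"
  note append = word_val_append[where f = f, OF f] and replicate = word_val_replicate[where f = f, OF f]
  have letters: "letter_val G f (Tau, True) = t" "letter_val G f (Sigma, True) = s"
    "letter_val G f (Tau, False) = inv t"
    by (simp_all add: letter_val_def f_def)
  have "?v l = ?v r" if "(l, r) \<in> ?R" for l r
  proof -
    have "?v [] = \<one>" by (simp add: word_val_def)
    moreover have "?v [(Tau, True), (Sigma, True)] = ?v ((Sigma, True) # replicate (d - 1) (Tau, False))"
      using append[of "[(Sigma, True)]" "replicate (d - 1) (Tau, False)"] rels(3) s t
      by (simp add: replicate letters) (simp add: word_val_def letters)
    ultimately show ?thesis
      using that rels s t n(1) by (auto simp: klein_relations_def replicate letters)
  qed
  then have val_cong: "?v u = ?v v" if "word_cong ?R u v" for u v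
    using word_val_cong[where f = f, OF f that] by blast
  define \<phi> where "\<phi> = (\<lambda>U. ?v (SOME u. u \<in> U))"
  have \<phi>: "\<phi> (word_class ?R u) = ?v u" for u
  proof -
    have "u \<in> word_class ?R u" by (simp add: word_class_def word_cong.refl)
    then have "(SOME v. v \<in> word_class ?R u) \<in> word_class ?R u" by (rule someI)
    then have "word_cong ?R u (SOME v. v \<in> word_class ?R u)" by (simp add: word_class_def)
    then show ?thesis by (simp add: \<phi>_def val_cong)
  qed
  have normal: "?v (replicate i (Sigma, True) @ replicate j (Tau, True)) = s [^] i \<otimes> t [^] j" for i j
    by (simp only: append replicate letters)
  have cls: "\<exists>u. U = word_class ?R u" if "U \<in> carrier ?P" for U
    using that by (auto simp: presented_group_def)
  have hom: "\<phi> \<in> hom ?P G"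
  proof (rule homI)
    fix U V assume "U \<in> carrier ?P" "V \<in> carrier ?P"
    then obtain u v where "U = word_class ?R u" "V = word_class ?R v" using cls by metis
    then show "\<phi> (U \<otimes>\<^bsub>?P\<^esub> V) = \<phi> U \<otimes> \<phi> V"
      by (simp add: presented_group_mult \<phi> append)
  next
    fix U assume "U \<in> carrier ?P"
    then obtain u where "U = word_class ?R u" using cls by metis
    then show "\<phi> U \<in> carrier G" by (simp add: \<phi> word_val_closed f)
  qed
  then interpret hom: group_hom ?P G \<phi> by unfold_locales
  have "inj_on \<phi> (carrier ?P)"
  proof (rule hom.inj_on_one_iff[THEN iffD2], intro allI impI)
    fix U assume U: "U \<in> carrier ?P" "\<phi> U = \<one>"
    then obtain u where u: "U = word_class ?R u" using cls by metis
    then obtain i j where ij: "i < 3" "j < n"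
      "U = word_class ?R (replicate i (Sigma, True) @ replicate j (Tau, True))"
      using klein_presented_group_normal_form[OF n, of u] by metis
    then have "i = 0 \<and> j = 0" using U(2) distinct by (simp add: \<phi> normal)
    then show "U = \<one>\<^bsub>?P\<^esub>" using ij(3) by (simp add: presented_group_def)
  qed
  moreover have "\<phi> ` carrier ?P = carrier G"
  proof
    show "\<phi> ` carrier ?P \<subseteq> carrier G" using hom.hom_closed by blast
    show "carrier G \<subseteq> \<phi> ` carrier ?P"
    proof
      fix g assume "g \<in> carrier G"
      then obtain i j where "g = s [^] (i::nat) \<otimes> t [^] (j::nat)" using generate by blast
      then have "g = \<phi> (word_class ?R (replicate i (Sigma, True) @ replicate j (Tau, True)))"
        by (simp add: \<phi> normal)
      then show "g \<in> \<phi> ` carrier ?P" by (simp add: presented_group_def)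
    qed
  qed
  ultimately have "\<phi> \<in> iso ?P G" using hom by (simp add: iso_def bij_betw_def)
  then have "?P \<cong> G" by (auto simp: is_iso_def)
  then show ?thesis using P.iso_sym by blast
qed

section \<open>Projectivities\<close>

text \<open>The assumption means \<open>F (B v) = \<kappa> * G v\<close>, so \<open>B\<close> maps
  the curve of \<open>G\<close> to that of \<open>F\<close>, opposite to the substitution. The
  coordinates of \<open>B v\<close> are linear forms without a common zero, so a single chart with
  \<open>H = 1\<close> suffices.\<close>

lemma curve_morphism_linear:
  fixes F G :: "'k::field poly3"
  assumes B: "invertible B" and "\<kappa> \<noteq> 0" and FG: "linear_subst B F = Const \<kappa> * G"
  shows "curve_morphism G F ((`) ((*v) B))"
proof -
  have image: "(*v) B ` proj_point v = proj_point (B *v v)" for v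
    by (simp add: proj_point_def setcompr_eq_image image_image vec.linear_scale[OF matrix_vector_mul_linear_gen])
  have nonzero: "B *v v \<noteq> 0" if "v \<noteq> 0" for v
    using B that unfolding invertible_def
    by (metis matrix_vector_mul_assoc matrix_vector_mul_lid matrix_vector_mult_0_right)
  have eval: "poly3_eval F (B *v v) = \<kappa> * poly3_eval G v" for v
    using arg_cong[OF FG, of "\<lambda>p. poly3_eval p v"]
    by (simp add: poly3_eval_linear_subst poly3_eval_Const_mult)
  show ?thesis
    unfolding curve_morphism_def
  proof (intro conjI allI impI)
    show "(`) ((*v) B) \<in> curve_points G \<rightarrow> curve_points F"
    proof
      fix p assume "p \<in> curve_points G"
      then obtain v where "p = proj_point v" "v \<noteq> 0" "poly3_eval G v = 0"
        by (auto simp: curve_points_def)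
      then have "(*v) B ` p = proj_point (B *v v) \<and> B *v v \<noteq> 0 \<and> poly3_eval F (B *v v) = 0"
        by (simp add: image nonzero eval)
      then show "(*v) B ` p \<in> curve_points F" unfolding curve_points_def by blast
    qed
    have P: "(\<chi> i. poly3_eval (linear_subst B (Var i)) w) = B *v w" for w
      by (simp add: poly3_eval_linear_subst poly3_eval_Var)
    have H: "poly3_eval (Const 1) w = 1" for w :: "'k^3"
      unfolding poly3_eval_def Const_def by (subst insertion_single) simp_all
    show "\<exists>H P m n. homogeneous m H \<and> (\<forall>i. homogeneous n (P i)) \<and> poly3_eval H v \<noteq> 0 \<and>
        (\<forall>w. w \<noteq> 0 \<and> poly3_eval G w = 0 \<and> poly3_eval H w \<noteq> 0 \<longrightarrow>
          (\<chi> i. poly3_eval (P i) w) \<noteq> 0 \<and>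
          (*v) B ` proj_point w = proj_point (\<chi> i. poly3_eval (P i) w))" for v
    proof (intro exI conjI)
      show "homogeneous 0 (Const 1 :: 'k poly3)" by (simp add: homogeneous_def Const_def)
      show "\<forall>i. homogeneous 1 (linear_subst B (Var i))"
        by (intro allI homogeneous_linear_subst) (simp add: homogeneous_def Var_def lookup_single when_def)
      show "poly3_eval (Const 1) v \<noteq> 0" by (simp only: H) simp
      show "\<forall>w. w \<noteq> 0 \<and> poly3_eval G w = 0 \<and> poly3_eval (Const 1) w \<noteq> 0 \<longrightarrow>
          (\<chi> i. poly3_eval (linear_subst B (Var i)) w) \<noteq> 0 \<and>
          (*v) B ` proj_point w = proj_point (\<chi> i. poly3_eval (linear_subst B (Var i)) w)"
        unfolding P by (simp add: image nonzero)
    qed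
  qed
qed

lemma linear_subst_inverse:
  fixes F G :: "'k::field poly3"
  assumes "B ** C = mat 1" "\<kappa> \<noteq> 0" "linear_subst B F = Const \<kappa> * G"
  shows "linear_subst C G = Const (inverse \<kappa>) * F"
proof -
  have "Const \<kappa> * linear_subst C G = linear_subst C (linear_subst B F)"
    by (simp add: assms(3) linear_subst_mult linear_subst_Const)
  also have "\<dots> = F"
    by (simp add: linear_subst_linear_subst assms(1) linear_subst_one_matrix)
  finally have "Const (inverse \<kappa>) * F = Const (inverse \<kappa>) * Const \<kappa> * linear_subst C G"
    by (simp only: mult.assoc)
  moreover have "Const (inverse \<kappa>) * Const \<kappa> = (1 :: 'k poly3)"
    using assms(2) Const_hom(4)[of "inverse \<kappa>" \<kappa>] by simp
  ultimately show ?thesis by simp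
qed

lemma curves_isomorphic_linear:
  fixes F G :: "'k::field poly3"
  assumes B: "invertible B" and \<kappa>: "\<kappa> \<noteq> 0" and FG: "linear_subst B F = Const \<kappa> * G"
  shows "curves_isomorphic F G"
proof -
  obtain C where C: "B ** C = mat 1" "C ** B = mat 1"
    using B by (auto simp: invertible_def)
  then have "invertible C" by (auto simp: invertible_def)
  then have "curve_morphism F G ((`) ((*v) C))"
    by (rule curve_morphism_linear[OF _ _ linear_subst_inverse[OF C(1) \<kappa> FG]]) (use \<kappa> in simp)
  moreover have "curve_morphism G F ((`) ((*v) B))"
    by (rule curve_morphism_linear[OF assms])
  moreover have "(*v) B ` (*v) C ` p = p" "(*v) C ` (*v) B ` p = p" for p
    by (simp_all add: image_image matrix_vector_mul_assoc C)
  ultimately show ?thesis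
    unfolding curves_isomorphic_def
    by (intro exI[of _ "(`) ((*v) C)"] exI[of _ "(`) ((*v) B)"]) simp
qed

section \<open>Automorphisms as matrices modulo scalars\<close>

definition projectivity :: "'k::field^3^3 \<Rightarrow> ('k^3^3) set" where
  "projectivity A = scalar_matrices #>\<^bsub>GL3\<^esub> A"

lemma projectivity_mult:
  assumes "invertible A" "invertible B"
  shows "projectivity A \<otimes>\<^bsub>PGL3\<^esub> projectivity B = projectivity (A ** B)"
proof -
  interpret N: normal scalar_matrices GL3 by (rule normal_scalar_matrices)
  show ?thesis
    using N.rcos_sum[of A B] assms by (simp add: PGL3_def projectivity_def GL3_def)
qed

lemma projectivity_eq_iff:
  "projectivity A = projectivity B \<longleftrightarrow> (\<exists>c. c \<noteq> 0 \<and> A = mat c ** (B :: 'k::field^3^3))"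
proof -
  have coset: "projectivity B = {mat c ** B | c. c \<noteq> 0}" for B :: "'k^3^3"
    by (auto simp: projectivity_def r_coset_def scalar_matrices_def GL3_def)
  show ?thesis
  proof
    assume "projectivity A = projectivity B"
    moreover have "mat 1 ** A \<in> projectivity A" unfolding coset by (auto intro: exI[of _ 1])
    ultimately show "\<exists>c. c \<noteq> 0 \<and> A = mat c ** B" by (auto simp: coset)
  next
    assume "\<exists>c. c \<noteq> 0 \<and> A = mat c ** B"
    then obtain c where c: "c \<noteq> 0" "A = mat c ** B" by blast
    have "mat a ** A \<in> projectivity B" if "a \<noteq> 0" for a
      using that c unfolding coset
      by (intro CollectI exI[of _ "a * c"]) (simp add: matrix_mul_assoc mat_mult_mat)
    moreover have "mat a ** B \<in> projectivity A" if "a \<noteq> 0" for a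
      using that c unfolding coset
      by (intro CollectI exI[of _ "a / c"]) (simp add: matrix_mul_assoc mat_mult_mat)
    ultimately show "projectivity A = projectivity B"
      by (auto simp: coset)
  qed
qed

lemma carrier_Aut: "carrier (Aut F) = {projectivity A | A. invertible A \<and> preserves_equation A F}"
  by (auto simp: Aut_def projectivity_def GL3_def)

lemma mult_Aut: "mult (Aut F) = mult PGL3"
  by (simp add: Aut_def)

lemma one_Aut: "\<one>\<^bsub>Aut F\<^esub> = projectivity (mat 1)"
proof -
  have "mat 1 ** A = (A :: 'a^3^3)" for A by simp
  then show ?thesis
    by (auto simp: Aut_def PGL3_def FactGroup_def projectivity_def r_coset_def GL3_def)
qed

text \<open>This translates powers in the automorphism group into iterates of a linear map, the form
  used for diagonalization.\<close>

lemma projectivity_pow: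
  assumes "invertible A"
  shows "\<exists>B. invertible B \<and> projectivity A [^]\<^bsub>Aut F\<^esub> (k::nat) = projectivity B \<and>
    (\<forall>v. B *v v = ((*v) A ^^ k) v)"
proof (induction k)
  case 0
  show ?case by (intro exI[of _ "mat 1"]) (simp add: one_Aut invertible_mat)
next
  case (Suc k)
  then obtain B where "invertible B" "projectivity A [^]\<^bsub>Aut F\<^esub> k = projectivity B"
    and B: "\<And>v. B *v v = ((*v) A ^^ k) v" by blast
  moreover have "(B ** A) *v v = ((*v) A ^^ Suc k) v" for v
    by (simp only: B funpow_Suc_right o_apply flip: matrix_vector_mul_assoc)
  ultimately show ?case
    using assms by (intro exI[of _ "B ** A"]) (simp add: invertible_mult mult_Aut projectivity_mult)
qed

lemma projectivity_eq_one_iff: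
  assumes "invertible (A :: 'k::field^3^3)"
  shows "projectivity A = \<one>\<^bsub>Aut F\<^esub> \<longleftrightarrow> (\<exists>c. \<forall>v. A *v v = c *s v)"
proof -
  have mat: "mat c *v v = c *s v" for c and v :: "'k^3"
    by (simp add: mat_def matrix_vector_mult_def vec_eq_iff if_distrib[of "\<lambda>x. x * _"] cong: if_cong)
  show ?thesis
    unfolding one_Aut projectivity_eq_iff
  proof
    assume "\<exists>c. c \<noteq> 0 \<and> A = mat c ** mat 1"
    then show "\<exists>c. \<forall>v. A *v v = c *s v" by (auto simp: mat)
  next
    assume "\<exists>c. \<forall>v. A *v v = c *s v"
    then obtain c where c: "\<And>v. A *v v = c *s v" by blast
    have "A *v axis 1 1 \<noteq> A *v 0"
      using assms unfolding invertible_def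
      by (metis axis_eq_0_iff matrix_vector_mul_assoc matrix_vector_mul_lid zero_neq_one)
    then have "c \<noteq> 0" by (auto simp: c)
    moreover have "A = mat c ** mat 1"
      unfolding matrix_eq by (simp add: c mat)
    ultimately show "\<exists>c. c \<noteq> 0 \<and> A = mat c ** mat 1" by blast
  qed
qed

text \<open>Conjugation by the change of coordinates is the isomorphism; conjugation the other way
  is its inverse.\<close>

lemma Aut_iso_linear:
  fixes F G :: "'k::field poly3"
  assumes B: "invertible B" and \<kappa>: "\<kappa> \<noteq> 0" and FG: "linear_subst B F = Const \<kappa> * G"
  shows "Aut F \<cong> Aut G"
proof -
  obtain C where C: "B ** C = mat 1" "C ** B = mat 1"
    using B by (auto simp: invertible_def)
  then have "invertible C" by (auto simp: invertible_def)
  \<comment> \<open>The general form serves both directions, with \<open>B\<close>,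
    \<open>C\<close>, \<open>\<kappa>\<close> and with \<open>C\<close>, \<open>B\<close>,
    \<open>inverse \<kappa>\<close>.\<close>
  have conj: "preserves_equation (Y ** A ** X) G'"
    if "preserves_equation A F'" "linear_subst X F' = Const k * G'" "X ** Y = mat 1" "k \<noteq> 0"
    for A X Y :: "'k^3^3" and F' G' k
  proof -
    obtain a where a: "a \<noteq> 0" "linear_subst A F' = Const a * F'"
      using \<open>preserves_equation A F'\<close> by (auto simp: preserves_equation_def)
    have "Const k * linear_subst (Y ** A ** X) G' = linear_subst (X ** (Y ** A ** X)) F'"
      by (simp add: linear_subst_mult linear_subst_Const that(2) flip: linear_subst_linear_subst)
    also have "X ** (Y ** A ** X) = A ** X" by (simp add: matrix_mul_assoc that(3))
    also have "linear_subst (A ** X) F' = Const k * (Const a * G')"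
      by (simp add: a that(2) linear_subst_mult linear_subst_Const mult.left_commute
          flip: linear_subst_linear_subst)
    finally have "Const (inverse k) * Const k * linear_subst (Y ** A ** X) G' =
        Const (inverse k) * Const k * (Const a * G')" by (simp only: mult.assoc)
    moreover have "Const (inverse k) * Const k = (1 :: 'k poly3)"
      using \<open>k \<noteq> 0\<close> Const_hom(4)[of "inverse k" k] by simp
    ultimately have "linear_subst (Y ** A ** X) G' = Const a * G'" by simp
    then show ?thesis using a(1) by (auto simp: preserves_equation_def)
  qed
  define h where "h = (\<lambda>X. projectivity C \<otimes>\<^bsub>PGL3\<^esub> X \<otimes>\<^bsub>PGL3\<^esub> projectivity B)"
  define h' where "h' = (\<lambda>X. projectivity B \<otimes>\<^bsub>PGL3\<^esub> X \<otimes>\<^bsub>PGL3\<^esub> projectivity C)"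
  have h: "h (projectivity A) = projectivity (C ** A ** B)"
    and h': "h' (projectivity A) = projectivity (B ** A ** C)" if "invertible A" for A
    using that B \<open>invertible C\<close> by (simp_all add: h_def h'_def projectivity_mult invertible_mult)
  have GF: "linear_subst C G = Const (inverse \<kappa>) * F" "inverse \<kappa> \<noteq> 0"
    using linear_subst_inverse[OF C(1) \<kappa> FG] \<kappa> by simp_all
  have "h X \<in> carrier (Aut G) \<and> h' (h X) = X" if X: "X \<in> carrier (Aut F)" for X
  proof -
    obtain A where A: "X = projectivity A" "invertible A" "preserves_equation A F"
      using X by (auto simp: carrier_Aut)
    have "invertible (C ** A ** B)" using A(2) B \<open>invertible C\<close> by (simp add: invertible_mult)
    moreover have "B ** (C ** A ** B) ** C = (B ** C) ** A ** (B ** C)"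
      by (simp only: matrix_mul_assoc)
    then have "B ** (C ** A ** B) ** C = A"
      by (simp only: C matrix_mul_lid matrix_mul_rid)
    ultimately show ?thesis
      using A conj[OF A(3) FG C(1) \<kappa>] by (auto simp: h h' carrier_Aut)
  qed
  moreover have "h' X \<in> carrier (Aut F) \<and> h (h' X) = X" if X: "X \<in> carrier (Aut G)" for X
  proof -
    obtain A where A: "X = projectivity A" "invertible A" "preserves_equation A G"
      using X by (auto simp: carrier_Aut)
    have "invertible (B ** A ** C)" using A(2) B \<open>invertible C\<close> by (simp add: invertible_mult)
    moreover have "C ** (B ** A ** C) ** B = (C ** B) ** A ** (C ** B)"
      by (simp only: matrix_mul_assoc)
    then have "C ** (B ** A ** C) ** B = A"
      by (simp only: C matrix_mul_lid matrix_mul_rid)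
    ultimately show ?thesis
      using A conj[OF A(3) GF(1) C(2) GF(2)] by (auto simp: h h' carrier_Aut)
  qed
  ultimately have "bij_betw h (carrier (Aut F)) (carrier (Aut G))"
    by (intro bij_betw_byWitness[where f' = h']) auto
  moreover have "h \<in> hom (Aut F) (Aut G)"
  proof (rule homI)
    show "h X \<in> carrier (Aut G)" if "X \<in> carrier (Aut F)" for X
      using \<open>bij_betw h (carrier (Aut F)) (carrier (Aut G))\<close> that by (auto simp: bij_betw_def)
    fix X Y assume "X \<in> carrier (Aut F)" "Y \<in> carrier (Aut F)"
    then obtain A A' where A: "X = projectivity A" "invertible A" and A': "Y = projectivity A'" "invertible A'"
      by (auto simp: carrier_Aut)
    have "C ** A ** B ** (C ** A' ** B) = C ** A ** (B ** C) ** A' ** B"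
      by (simp only: matrix_mul_assoc)
    also have "\<dots> = C ** (A ** A') ** B"
      by (simp only: C matrix_mul_rid matrix_mul_assoc)
    finally have "C ** A ** B ** (C ** A' ** B) = C ** (A ** A') ** B" .
    then show "h (X \<otimes>\<^bsub>Aut F\<^esub> Y) = h X \<otimes>\<^bsub>Aut G\<^esub> h Y"
      using A A' B \<open>invertible C\<close> by (simp add: mult_Aut projectivity_mult h invertible_mult)
  qed
  ultimately show ?thesis by (auto simp: is_iso_def iso_def)
qed

section \<open>The automorphism group of the Klein curve\<close>

lemma mat_eq_monomial_matrix: "mat c = monomial_matrix (\<lambda>_. c) id"
  by (simp add: mat_def monomial_matrix_def vec_eq_iff)

lemma bij_diff_3: "bij (\<lambda>l :: 3. l - r)"
  by (rule bij_betw_byWitness[where f' = "\<lambda>l. l + r"]) auto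

lemma klein_curve_altdef:
  "klein_curve d = (\<Sum>i\<in>UNIV. Var i ^ (d - 1) * Var (i + 1))"
proof -
  have "(1::3) + 1 = 2" "(2::3) + 1 = 3" "(3::3) + 1 = 1" by simp_all
  then show ?thesis by (simp only: klein_curve_def sum_3)
qed

text \<open>A rotation permutes the three terms of the cyclic sum, and the scalars multiply each of
  them by the same \<open>c\<close>.\<close>

lemma preserves_equation_klein_monomial:
  fixes a :: "3 \<Rightarrow> 'k::field"
  assumes "c \<noteq> 0" and weights: "\<And>i. a i ^ (d - 1) * a (i + 1) = c"
  shows "preserves_equation (monomial_matrix (\<lambda>l. a (l - r)) (\<lambda>l. l - r)) (klein_curve d)"
proof -
  let ?A = "monomial_matrix (\<lambda>l. a (l - r)) (\<lambda>l. l - r)"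
  have Const_power: "Const b ^ n = (Const (b ^ n) :: 'k poly3)" for b n
    by (induction n) simp_all
  have "linear_subst ?A (klein_curve d) = (\<Sum>i\<in>UNIV. Const (a (i - r) ^ (d - 1) * a (i - r + 1)) *
      (Var (i - r) ^ (d - 1) * Var (i - r + 1)))"
    by (simp add: klein_curve_altdef linear_subst_sum linear_subst_mult linear_subst_power
        linear_subst_Var linear_form_monomial_matrix power_mult_distrib Const_power mult_ac
        add_diff_eq[symmetric] diff_add_eq)
  also have "\<dots> = Const c * (\<Sum>i\<in>UNIV. Var (i - r) ^ (d - 1) * Var (i - r + 1))"
    unfolding weights by (simp only: sum_distrib_left)
  also have "(\<Sum>i\<in>UNIV. Var (i - r) ^ (d - 1) * Var (i - r + 1)) = (klein_curve d :: 'k poly3)"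
    unfolding klein_curve_altdef
    by (rule sum.reindex_bij_betw[OF bij_diff_3, of "\<lambda>i. Var i ^ (d - 1) * Var (i + 1)"])
  finally show ?thesis using assms(1) by (auto simp: preserves_equation_def)
qed

text \<open>The first \<open>n\<close> powers of \<open>x\<close> are distinct, and there are only
  \<open>n\<close> roots of unity of order dividing \<open>n\<close>.\<close>

lemma root_of_unity_is_power:
  fixes x y :: "'k::{alg_closed_field, field_char_0}"
  assumes n: "n > 0" and x: "\<And>k. x ^ k = 1 \<longleftrightarrow> n dvd k" and y: "y ^ n = 1"
  shows "\<exists>j. y = x ^ j"
proof -
  have "x \<noteq> 0" using x[of n] n by (auto simp: power_0_left)
  have le: "i = j" if "i \<le> j" "j < n" "x ^ i = x ^ j" for i j
  proof -
    have "x ^ (j - i) = 1" using that \<open>x \<noteq> 0\<close> by (simp add: power_diff)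
    then have "n dvd j - i" using x by simp
    then have "j - i = 0" using that(2) nat_dvd_not_less[of "j - i" n] by linarith
    then show ?thesis using that(1) by simp
  qed
  have "inj_on (\<lambda>j. x ^ j) {..<n}"
  proof (rule inj_onI)
    fix i j assume "i \<in> {..<n}" "j \<in> {..<n}" "x ^ i = x ^ j"
    then show "i = j" using le[of i j] le[of j i] by (cases "i \<le> j") auto
  qed
  then have "card ((\<lambda>j. x ^ j) ` {..<n}) = card {r :: 'k. r ^ n = 1}"
    using card_nth_roots_alg_closed[OF n, of "1::'k"] by (simp add: card_image)
  moreover have "finite {r :: 'k. r ^ n = 1}"
    using card_nth_roots_alg_closed[OF n, of "1::'k"] n by (intro card_ge_0_finite) simp
  moreover have "x ^ n = 1" using x by simp
  then have "(\<lambda>j. x ^ j) ` {..<n} \<subseteq> {r. r ^ n = 1}"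
    by (auto simp: power_mult[symmetric]) (metis mult.commute power_mult power_one)
  ultimately have "(\<lambda>j. x ^ j) ` {..<n} = {r. r ^ n = 1}"
    by (metis card_subset_eq)
  then show ?thesis using y by blast
qed

lemma Aut_klein_curve:
  assumes d: "d \<ge> 5" and x: "\<And>k. (x :: 'k::{alg_closed_field, field_char_0}) ^ k = 1 \<longleftrightarrow> d\<^sup>2 - 3 * d + 3 dvd k"
  shows "Aut (klein_curve d :: 'k poly3) \<cong> presented_group (klein_relations d)"
proof -
  let ?G = "Aut (klein_curve d :: 'k poly3)"
  interpret G: group ?G by (rule group_Aut)
  define n where "n = d\<^sup>2 - 3 * d + 3"
  define N where "N = d - 2"
  have N: "d = N + 2" using d by (simp add: N_def)
  have n: "n = N * (N + 1) + 1" using d by (simp add: n_def N power2_eq_square algebra_simps)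
  have xn: "x ^ n = 1" using x by (simp add: n_def)
  then have "x \<noteq> 0" using n by (auto simp: power_0_left)
  \<comment> \<open>With third entry 1 and first entry \<open>x\<close>, the common weight is
    \<open>x\<close> and the second entry is forced to be the inverse of
    \<open>x ^ (d - 2)\<close>.\<close>
  define \<tau> :: "3 \<Rightarrow> 'k" where "\<tau> = (\<lambda>i. if i = 1 then x else if i = 2 then inverse (x ^ N) else 1)"
  have \<tau>: "\<tau> 1 = x" "\<tau> 2 = inverse (x ^ N)" "\<tau> 3 = 1" by (simp_all add: \<tau>_def)
  have \<tau>0: "\<tau> i \<noteq> 0" for i using \<open>x \<noteq> 0\<close> by (simp add: \<tau>_def)
  have four: "(4::3) = 1" by simp
  have succ: "(1::3) + 1 = 2" "(2::3) + 1 = 3" "(3::3) + 1 = 1" by simp_all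
  have weights: "\<tau> i ^ (d - 1) * \<tau> (i + 1) = x" for i
  proof -
    have "inverse (x ^ N) ^ (N + 1) = x"
    proof -
      have "(x ^ N) ^ (N + 1) * x = 1"
        using xn by (simp only: n power_add[of x "N * (N + 1)"] power_mult power_one_right)
      then show ?thesis unfolding power_inverse by (rule inverse_unique)
    qed
    then show ?thesis
      using \<open>x \<noteq> 0\<close> exhaust_3[of i] succ by (elim disjE) (simp_all add: \<tau> N four)
  qed
  \<comment> \<open>These classes turn out to be the normal forms: rotation by \<open>i\<close>
    times the \<open>j\<close>-th power of the diagonal generator.\<close>
  let ?m = "\<lambda>i j. projectivity (monomial_matrix (\<lambda>l. \<tau> (l - of_nat i) ^ j) (\<lambda>l. l - of_nat i))"
  have inv: "invertible (monomial_matrix (\<lambda>l. a (l - r)) (\<lambda>l. l - r))" if "\<And>i. a i \<noteq> 0"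
    for a :: "3 \<Rightarrow> 'k" and r
    using that by (intro invertible_monomial_matrix bij_diff_3) simp
  have mem: "projectivity (monomial_matrix (\<lambda>l. a (l - r)) (\<lambda>l. l - r)) \<in> carrier ?G"
    if "\<And>i. a i \<noteq> 0" "\<And>i. a i ^ (d - 1) * a (i + 1) = c" for a :: "3 \<Rightarrow> 'k" and r c
  proof -
    have "c \<noteq> 0" using that(1) that(2)[of 1] by auto
    then show ?thesis
      unfolding carrier_Aut using inv[of a r] preserves_equation_klein_monomial[of c a d r] that by blast
  qed
  define t where "t = ?m 0 1"
  define s where "s = ?m 1 0"
  have t: "t \<in> carrier ?G"
    using mem[of \<tau> x 0] \<tau>0 weights by (simp add: t_def)
  have s: "s \<in> carrier ?G"
    using mem[of "\<lambda>_. 1" 1 1] by (simp add: s_def)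
  have mult: "projectivity (monomial_matrix (\<lambda>l. a (l - r)) (\<lambda>l. l - r)) \<otimes>\<^bsub>?G\<^esub>
      projectivity (monomial_matrix (\<lambda>l. b (l - q)) (\<lambda>l. l - q)) =
      projectivity (monomial_matrix (\<lambda>l. a (l - r) * b (l - r - q)) (\<lambda>l. l - (r + q)))"
    if "\<And>i. a i \<noteq> 0" "\<And>i. b i \<noteq> 0" for a b :: "3 \<Rightarrow> 'k" and r q
    using inv[of a r] inv[of b q] that
    by (simp add: mult_Aut projectivity_mult monomial_matrix_mult o_def diff_diff_eq)
  have scale: "projectivity (monomial_matrix (\<lambda>l. c * a l) \<pi>) = projectivity (monomial_matrix a \<pi>)"
    if "c \<noteq> 0" for c and a :: "3 \<Rightarrow> 'k" and \<pi>
    unfolding projectivity_eq_iff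
    using that by (intro exI[of _ c]) (simp add: mat_eq_monomial_matrix monomial_matrix_mult)
  have one: "\<one>\<^bsub>?G\<^esub> = ?m 0 0"
    by (simp add: one_Aut mat_eq_monomial_matrix id_def)
  have t_pow: "t [^]\<^bsub>?G\<^esub> j = ?m 0 j" for j :: nat
  proof (induction j)
    case (Suc j)
    have "t [^]\<^bsub>?G\<^esub> Suc j = ?m 0 j \<otimes>\<^bsub>?G\<^esub> ?m 0 1" unfolding G.nat_pow_Suc Suc by (simp only: t_def)
    also have "\<dots> = ?m 0 (Suc j)"
      using mult[of "\<lambda>l. \<tau> l ^ j" \<tau> 0 0] \<tau>0 by (simp add: mult.commute)
    finally show ?case .
  qed (simp add: one)
  have s_pow: "s [^]\<^bsub>?G\<^esub> i = ?m i 0" for i :: nat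
  proof (induction i)
    case (Suc i)
    have "s [^]\<^bsub>?G\<^esub> Suc i = ?m i 0 \<otimes>\<^bsub>?G\<^esub> ?m 1 0" unfolding G.nat_pow_Suc Suc by (simp only: s_def)
    also have "\<dots> = ?m (Suc i) 0"
      using mult[of "\<lambda>_. 1" "\<lambda>_. 1" "of_nat i" 1] by (simp add: add.commute)
    finally show ?case .
  qed (simp add: one)
  have st: "s [^]\<^bsub>?G\<^esub> i \<otimes>\<^bsub>?G\<^esub> t [^]\<^bsub>?G\<^esub> j = projectivity
      (monomial_matrix (\<lambda>l. \<tau> (l - of_nat i) ^ j) (\<lambda>l. l - of_nat i))" for i j :: nat
    unfolding s_pow t_pow using mult[of "\<lambda>_. 1" "\<lambda>l. \<tau> l ^ j" "of_nat i" 0] \<tau>0 by simp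
  have "t [^]\<^bsub>?G\<^esub> n = \<one>\<^bsub>?G\<^esub>"
  proof -
    have "\<tau> l ^ n = 1" for l
      using xn exhaust_3[of l]
      by (auto simp: \<tau> power_inverse mult.commute[of N] simp flip: power_mult) (simp add: power_mult)
    then show ?thesis by (simp add: t_pow one)
  qed
  moreover have "s [^]\<^bsub>?G\<^esub> (3::nat) = \<one>\<^bsub>?G\<^esub>"
  proof -
    have zero: "of_nat 3 = (0::3)" by simp
    show ?thesis unfolding s_pow one zero by simp
  qed
  moreover have "t \<otimes>\<^bsub>?G\<^esub> s = s \<otimes>\<^bsub>?G\<^esub> (inv\<^bsub>?G\<^esub> t) [^]\<^bsub>?G\<^esub> (d - 1)"
  proof -
    have "t [^]\<^bsub>?G\<^esub> (d - 1) \<otimes>\<^bsub>?G\<^esub> (inv\<^bsub>?G\<^esub> t) [^]\<^bsub>?G\<^esub> (d - 1) = \<one>\<^bsub>?G\<^esub>"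
      using t by (simp add: G.nat_pow_inv)
    \<comment> \<open>The defining relation is the weight equation in disguise: the non-zero entries
      of the product are \<open>\<tau> (i + 1) * \<tau> i ^ (d - 1) = x\<close>, so it is a scalar
      multiple of the rotation.\<close>
    moreover have "t \<otimes>\<^bsub>?G\<^esub> s \<otimes>\<^bsub>?G\<^esub> t [^]\<^bsub>?G\<^esub> (d - 1) = s"
    proof -
      have "t \<otimes>\<^bsub>?G\<^esub> s = projectivity (monomial_matrix (\<lambda>l. \<tau> (l - 1 + 1)) (\<lambda>l. l - 1))"
        using mult[of \<tau> "\<lambda>_. 1" 0 1] \<tau>0 by (simp add: t_def s_def)
      then have "t \<otimes>\<^bsub>?G\<^esub> s \<otimes>\<^bsub>?G\<^esub> t [^]\<^bsub>?G\<^esub> (d - 1) = projectivity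
          (monomial_matrix (\<lambda>l. \<tau> (l - 1 + 1) * \<tau> (l - 1) ^ (d - 1)) (\<lambda>l. l - 1))"
        unfolding t_pow using mult[of "\<lambda>l. \<tau> (l + 1)" "\<lambda>l. \<tau> l ^ (d - 1)" 1 0] \<tau>0 by simp
      also have "(\<lambda>l. \<tau> (l - 1 + 1) * \<tau> (l - 1) ^ (d - 1)) = (\<lambda>l. x * 1)"
        using weights by (simp only: mult.commute[of "\<tau> (_ + 1)"] mult_1_right)
      also have "projectivity (monomial_matrix (\<lambda>l::3. x * 1) (\<lambda>l. l - 1)) = s"
        unfolding scale[OF \<open>x \<noteq> 0\<close>] by (simp add: s_def)
      finally show ?thesis .
    qed
    ultimately show ?thesis
      using s t by (metis G.m_assoc G.m_closed G.inv_closed G.nat_pow_closed G.r_one)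
  qed
  moreover have "\<exists>i j. g = s [^]\<^bsub>?G\<^esub> (i::nat) \<otimes>\<^bsub>?G\<^esub> t [^]\<^bsub>?G\<^esub> (j::nat)"
    if g: "g \<in> carrier ?G" for g
  proof -
    obtain A where A: "g = projectivity A" "invertible A" "preserves_equation A (klein_curve d)"
      using g by (auto simp: carrier_Aut)
    obtain c where c: "c \<noteq> 0" "linear_subst A (klein_curve d) = Const c * klein_curve d"
      using A(3) by (auto simp: preserves_equation_def)
    have "poly3_eval (klein_curve d) (A *v v) = c * poly3_eval (klein_curve d) v" for v
      using arg_cong[OF c(2), of "\<lambda>p. poly3_eval p v"]
      by (simp add: poly3_eval_linear_subst poly3_eval_Const_mult)
    then obtain r a where a: "A = monomial_matrix (\<lambda>l. a (l - r)) (\<lambda>l. l - r)" "\<And>i. a i \<noteq> 0"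
      "\<And>i. a i ^ (d - 1) * a (i + 1) = c"
      using klein_automorphism_monomial[OF d A(2) c(1)] by blast
    have "d \<ge> 4" using d by simp
    note ratios = klein_weight_ratios[OF this a(2) a(2) a(2) a(3)[of 1, unfolded succ]
        a(3)[of 2, unfolded succ] a(3)[of 3, unfolded succ]]
    \<comment> \<open>Modulo the scalar \<open>a 3\<close>, the entries are determined by the ratio
      \<open>a 1 / a 3\<close>, an \<open>n\<close>-th root of unity.\<close>
    obtain j where j: "a 1 / a 3 = x ^ j"
      using root_of_unity_is_power[of n x "a 1 / a 3"] x ratios(2) n by (auto simp: n_def)
    have a_\<tau>: "a l = a 3 * \<tau> l ^ j" for l
    proof -
      have "a 1 = a 3 * x ^ j" using j a(2)[of 3] by (simp add: field_simps)
      moreover have "a 2 = a 3 * inverse (x ^ N) ^ j"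
      proof -
        have "(x ^ N) ^ j * (a 2 / a 3) = 1"
          using ratios(1) j by (simp add: N_def mult.commute flip: power_mult)
        then have "a 2 / a 3 = inverse ((x ^ N) ^ j)"
          using \<open>x \<noteq> 0\<close> by (simp add: field_simps)
        then show ?thesis using a(2)[of 3] by (simp add: power_inverse field_simps)
      qed
      ultimately show ?thesis using exhaust_3[of l] by (auto simp: \<tau>)
    qed
    have "\<exists>i. r = of_nat i"
      using exhaust_3[of r] by (metis of_nat_1 of_nat_numeral)
    then obtain i :: nat where i: "r = of_nat i" by blast
    have "A = monomial_matrix (\<lambda>l. a 3 * \<tau> (l - of_nat i) ^ j) (\<lambda>l. l - of_nat i)"
      unfolding a(1) i by (subst a_\<tau>) simp
    then have "g = s [^]\<^bsub>?G\<^esub> i \<otimes>\<^bsub>?G\<^esub> t [^]\<^bsub>?G\<^esub> j"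
      unfolding st A(1) by (simp only: scale[OF a(2)])
    then show ?thesis by blast
  qed
  moreover have "i = 0 \<and> j = 0"
    if ij: "i < 3" "j < n" "s [^]\<^bsub>?G\<^esub> i \<otimes>\<^bsub>?G\<^esub> t [^]\<^bsub>?G\<^esub> j = \<one>\<^bsub>?G\<^esub>" for i j :: nat
  proof -
    obtain c where "monomial_matrix (\<lambda>l. \<tau> (l - of_nat i) ^ j) (\<lambda>l. l - of_nat i) = (mat c :: 'k^3^3)"
      using ij(3) unfolding st one_Aut projectivity_eq_iff by (auto simp: mat_mult_mat)
    then have entry: "monomial_matrix (\<lambda>l. \<tau> (l - of_nat i) ^ j) (\<lambda>l. l - of_nat i) $ l $ m =
        (mat c :: 'k^3^3) $ l $ m" for l m by simp
    \<comment> \<open>The non-zero entry of row 3 must be on the diagonal, which rules out a proper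
      rotation.\<close>
    have "3 - of_nat i = (3::3)"
      using entry[of 3 "3 - of_nat i"] \<tau>0 by (simp add: monomial_matrix_def mat_def split: if_splits)
    then have "of_nat i = (0::3)" by simp
    moreover have "i = 0 \<or> i = 1 \<or> i = 2" using ij(1) by auto
    ultimately have i: "i = 0" by auto
    have "\<tau> 1 ^ j = c" "\<tau> 3 ^ j = c"
      using entry[of 1 1] entry[of 3 3] by (simp_all add: i monomial_matrix_def mat_def)
    then have "x ^ j = 1" by (simp add: \<tau>)
    then have "n dvd j" using x by (simp add: n_def)
    then have "j = 0" using ij(2) by (meson nat_dvd_not_less neq0_conv)
    then show ?thesis using i by simp
  qed
  ultimately show ?thesis
    using iso_klein_presented_group[OF group_Aut n_def _ s t] n by simp
qed

theorem proposition45: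
  fixes F :: "'k::{alg_closed_field, field_char_0} poly3" and d :: nat
  assumes "d \<ge> 4"
    and "nonsingular_plane_curve d F"
    and "\<exists>\<alpha>\<in>carrier (Aut F). group.ord (Aut F) \<alpha> = d\<^sup>2 - 3 * d + 3"
  shows "curves_isomorphic F (klein_curve d) \<and>
         (d \<ge> 5 \<longrightarrow> Aut F \<cong> presented_group (klein_relations d))"
proof -
  interpret G: group "Aut F" by (rule group_Aut)
  let ?n = "d\<^sup>2 - 3 * d + 3"
  obtain \<alpha> where \<alpha>: "\<alpha> \<in> carrier (Aut F)" "G.ord \<alpha> = ?n" using assms(3) by blast
  then obtain A where A: "\<alpha> = projectivity A" "invertible A" "preserves_equation A F"
    by (auto simp: carrier_Aut)
  obtain c where c: "linear_subst A F = Const c * F"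
    using A(3) by (auto simp: preserves_equation_def)
  \<comment> \<open>Elements of \<open>Aut F\<close> are classes modulo scalars, so the order of
    \<open>\<alpha>\<close> is read off from the iterates of \<open>A\<close> that are
    scalar.\<close>
  have scalar: "?n dvd k \<longleftrightarrow> (\<exists>\<mu>. \<forall>v. ((*v) A ^^ k) v = \<mu> *s v)" for k
  proof -
    obtain B where B: "invertible B" "projectivity A [^]\<^bsub>Aut F\<^esub> k = projectivity B"
      "\<And>v. B *v v = ((*v) A ^^ k) v"
      using projectivity_pow[OF A(2)] by blast
    have "?n dvd k \<longleftrightarrow> \<alpha> [^]\<^bsub>Aut F\<^esub> k = \<one>\<^bsub>Aut F\<^esub>"
      using G.pow_eq_id[OF \<alpha>(1)] \<alpha>(2) by simp
    then show ?thesis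
      using projectivity_eq_one_iff[OF B(1)] by (simp add: A(1) B)
  qed
  obtain \<mu> where \<mu>: "\<And>v. ((*v) A ^^ ?n) v = \<mu> *s v"
    using scalar[of ?n] by auto
  have inj: "u = v" if "A *v u = A *v v" for u v
    using that A(2) unfolding invertible_def by (metis matrix_vector_mul_assoc matrix_vector_mul_lid)
  \<comment> \<open>The scalar \<open>\<mu>\<close> has to be non-zero, since the diagonalization
    takes roots of its inverse.\<close>
  have "((*v) A ^^ k) v \<noteq> 0" if "v \<noteq> 0" for k v
    by (induction k) (use that inj in \<open>auto dest: inj[of _ 0, simplified]\<close>)
  then have "((*v) A ^^ ?n) (axis 1 1) \<noteq> 0" by simp
  then have "\<mu> \<noteq> 0" unfolding \<mu> by auto
  note klein = automorphism_of_large_order_imp_klein[OF assms(1,2) A(2) c this \<mu>]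
  have ord: "?n dvd k" if "\<And>v. ((*v) A ^^ k) v = \<nu> *s v" for k \<nu>
    using scalar that by blast
  obtain B \<kappa> where B: "invertible B" "\<kappa> \<noteq> 0" "linear_subst B F = Const \<kappa> * klein_curve d"
    using klein(1) ord by blast
  obtain x :: 'k where x: "\<And>k. x ^ k = 1 \<longleftrightarrow> ?n dvd k"
    using klein(2) ord by blast
  have "Aut F \<cong> presented_group (klein_relations d)" if "d \<ge> 5"
    using iso_trans[OF Aut_iso_linear[OF B] Aut_klein_curve[OF that x]] .
  then show ?thesis
    using curves_isomorphic_linear[OF B] by blast
qed

end
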